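(* Let $1\le t\le r$. Let $H$ be a random $r\times t$ complex matrix that is full rank with probability $1$, with $E\|H\|_F^2<\infty$ and $E|\log\det(H^*H)|<\infty$, and let $\hat H$ be any random variable jointly distributed with $H$ (including the no-CSIT case where $\hat H$ is independent of $H$). Fix a positive definite $r\times r$ matrix $\Sigma_Z$, a positive definite $t\times t$ matrix $\Sigma_X'$ with $\mathrm{tr}(\Sigma_X')\le 1$, and a positive semidefinite $t\times t$ matrix $\Sigma_S'$; for $P>0$ put $\Sigma_X=P\Sigma_X'$ and $\Sigma_S=P\Sigma_S'$. Define the no-interference upper bound \[ R_0(P)=E_H\log\frac{|\Sigma_Z+H\Sigma_XH^*|}{|\Sigma_Z|} \] and the achievable rate \[ R(P)=E_{\hat H}\Big( E_{H|\hat H}\log\big\{|\Sigma_X|\,|H(\Sigma_X+\Sigma_S)H^*+\Sigma_Z|\big\} - \inf_{W\in\mathbb{C}^{t\times t}} E_{H|\hat H}\log|M(W,H)|\Big), \] where \[ M(W,H)=\begin{pmatrix}\Sigma_X+W\Sigma_S W^* & (\Sigma_X+W\Sigma_S)H^*\\ H(\Sigma_X+\Sigma_S W^* ) & H(\Sigma_X+\Sigma_S)H^*+\Sigma_Z\end{pmatrix}. \] Then $\Delta R(P)=R_0(P)-R(P)\to 0$ as $P\to\infty$.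
   Context: The $t\times r$ fading dirty paper channel is $Y=H(X+S)+Z$, with $X\sim\mathcal{CN}(0,\Sigma_X)\in\mathbb{C}^t$ the transmitted signal, $S\sim\mathcal{CN}(0,\Sigma_S)$ interference known non-causally at the transmitter but not at the receiver, $Z\sim\mathcal{CN}(0,\Sigma_Z)\in\mathbb{C}^r$ noise, $X,S,Z$ independent; $H$ is known perfectly at the receiver and the transmitter only knows $\hat H$. $R(P)$ is the rate achieved by dirty paper coding with auxiliary random variable $U=X+WS$ ($W$ the $t\times t$ inflation factor, chosen as a function of $\hat H$), and $R_0(P)$ is the rate achievable with the same input covariance in the absence of interference. $|A|$ denotes determinant and $A^*$ conjugate transpose. *)

theory Defs
  imports "HOL-Analysis.Analysis" "HOL-Probability.Probability"
begin

definition cadj :: "complex^'n^'m \<Rightarrow> complex^'m^'n" where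
  "cadj A = (\<chi> i j. cnj (A $ j $ i))"

definition hermitian :: "complex^'n^'n \<Rightarrow> bool" where
  "hermitian A \<longleftrightarrow> cadj A = A"

definition pos_def :: "complex^'n^'n \<Rightarrow> bool" where
  "pos_def A \<longleftrightarrow> hermitian A \<and>
     (\<forall>x. x \<noteq> 0 \<longrightarrow> 0 < Re (\<Sum>i\<in>UNIV. cnj (x $ i) * (A *v x) $ i))"

definition pos_semidef :: "complex^'n^'n \<Rightarrow> bool" where
  "pos_semidef A \<longleftrightarrow> hermitian A \<and>
     (\<forall>x. 0 \<le> Re (\<Sum>i\<in>UNIV. cnj (x $ i) * (A *v x) $ i))"

definition blockM :: "complex^'a^'a \<Rightarrow> complex^'b^'a \<Rightarrow> complex^'a^'b \<Rightarrow> complex^'b^'b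
    \<Rightarrow> complex^('a + 'b)^('a + 'b)" where
  "blockM A B C D = (\<chi> i j. case i of
       Inl a \<Rightarrow> (case j of Inl b \<Rightarrow> A $ a $ b | Inr b \<Rightarrow> B $ a $ b)
     | Inr a \<Rightarrow> (case j of Inl b \<Rightarrow> C $ a $ b | Inr b \<Rightarrow> D $ a $ b))"

text \<open>The matrix M(W,H) (covariance of (U, Y)).\<close>
definition Mmat :: "complex^'t^'t \<Rightarrow> complex^'t^'t \<Rightarrow> complex^'r^'r \<Rightarrow> complex^'t^'t
    \<Rightarrow> complex^'t^'r \<Rightarrow> complex^('t + 'r)^('t + 'r)" where
  "Mmat SX SS SZ W H = blockM (SX + W ** SS ** cadj W) ((SX + W ** SS) ** cadj H)
      (H ** (SX + SS ** cadj W)) (H ** (SX + SS) ** cadj H + SZ)"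

text \<open>Joint law of (H, Hhat): Hhat ~ Q, and H given Hhat = hh has law K hh.
  The law of H is Q \<bind> K.\<close>

definition R0 :: "'h measure \<Rightarrow> ('h \<Rightarrow> (complex^'t^'r) measure) \<Rightarrow> complex^'r^'r
    \<Rightarrow> complex^'t^'t \<Rightarrow> real \<Rightarrow> real" where
  "R0 Q K SZ SX' P = (\<integral>H. ln (Re (det (SZ + H ** (P *\<^sub>R SX') ** cadj H)) / Re (det SZ)) \<partial>(Q \<bind> K))"

definition Rach :: "'h measure \<Rightarrow> ('h \<Rightarrow> (complex^'t^'r) measure) \<Rightarrow> complex^'r^'r
    \<Rightarrow> complex^'t^'t \<Rightarrow> complex^'t^'t \<Rightarrow> real \<Rightarrow> real" where
  "Rach Q K SZ SX' SS' P =
    (let SX = P *\<^sub>R SX'; SS = P *\<^sub>R SS' in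
     \<integral>hh. ((\<integral>H. ln (Re (det SX) * Re (det (H ** (SX + SS) ** cadj H + SZ))) \<partial>(K hh))
            - (INF W. \<integral>H. ln (Re (det (Mmat SX SS SZ W H))) \<partial>(K hh))) \<partial>Q)"

end

theory Submission
  imports Defs "HOL-Computational_Algebra.Fundamental_Theorem_Algebra"
begin

text \<open>
  Taking \<open>W = I\<close> makes \<open>|M(I,H)| = |\<Sigma>X + \<Sigma>S| |\<Sigma>Z|\<close>, so the gap is at most the expectation of
  \<open>ln |\<Sigma>Z + H \<Sigma>X H*| - ln |\<Sigma>Z + H (\<Sigma>X + \<Sigma>S) H*|\<close> plus \<open>ln (|\<Sigma>X + \<Sigma>S| / |\<Sigma>X|)\<close>. By Sylvester's
  identity \<open>|\<Sigma>Z + P H A H*|\<close> is asymptotic to \<open>P^t |\<Sigma>Z| |A| |H* \<Sigma>Z^-1 H|\<close>, so the integrand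
  cancels the constant in the limit. Conversely
  \<open>|M(W,H)| |\<Sigma>Z + H \<Sigma>X H*| \<ge> |\<Sigma>X| |\<Sigma>Z| |\<Sigma>Z + H (\<Sigma>X + \<Sigma>S) H*|\<close> for every \<open>W\<close>: revealing the
  interference to the receiver cannot hurt. Hence the gap is nonnegative, and the same inequality at
  \<open>W = I\<close> bounds the integrand uniformly in \<open>P\<close>, so dominated convergence applies.

  The outer integral is meaningful only if the infimum over \<open>W\<close> is measurable in \<open>hh\<close>, also on the
  null set where conditional expectations diverge. There one uses that \<open>|M(W,H)|\<close> is a finite sum of
  products \<open>u(W) v(H)\<close>, so that its values at finitely many \<open>W\<close> control it everywhere.
\<close>

subsection \<open>Determinants of block matrices\<close>

lemma matrix_mult_minus_left: "(- A) ** B = - (A ** B)"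
  for A :: "'a::ring_1^'n^'m"
  by (simp add: vec_eq_iff matrix_matrix_mult_def sum_negf)

lemma matrix_mult_minus_right: "A ** (- B) = - (A ** B)"
  for A :: "'a::ring_1^'n^'m"
  by (simp add: vec_eq_iff matrix_matrix_mult_def sum_negf)

lemma matrix_diff_ldistrib: "A ** (B - C) = A ** B - A ** C"
  for A :: "'a::ring_1^'n^'m"
  by (simp add: vec_eq_iff matrix_matrix_mult_def right_diff_distrib sum_subtractf)

lemma matrix_diff_rdistrib: "(A - B) ** C = A ** C - B ** C"
  for A :: "'a::ring_1^'n^'m"
  by (simp add: vec_eq_iff matrix_matrix_mult_def left_diff_distrib sum_subtractf)

lemma matrix_add_rdistrib: "(A + B) ** C = A ** C + B ** C"
  for A :: "'a::ring_1^'n^'m"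
  by (simp add: vec_eq_iff matrix_matrix_mult_def distrib_right sum.distrib)

lemma blockM_nth [simp]:
  "blockM A B C D $ Inl a $ Inl a' = A $ a $ a'"
  "blockM A B C D $ Inl a $ Inr b = B $ a $ b"
  "blockM A B C D $ Inr b $ Inl a = C $ b $ a"
  "blockM A B C D $ Inr b $ Inr b' = D $ b $ b'"
  by (simp_all add: blockM_def)

lemma blockM_mult:
  "blockM A B C D ** blockM A' B' C' D' =
     blockM (A ** A' + B ** C') (A ** B' + B ** D') (C ** A' + D ** C') (C ** B' + D ** D')"
  unfolding vec_eq_iff
proof (intro allI)
  fix i j :: "'a + 'b"
  show "(blockM A B C D ** blockM A' B' C' D') $ i $ j =
     blockM (A ** A' + B ** C') (A ** B' + B ** D') (C ** A' + D ** C') (C ** B' + D ** D') $ i $ j"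
    by (cases i; cases j)
       (simp_all add: matrix_matrix_mult_def UNIV_Plus_UNIV[symmetric] sum.Plus
                 del: UNIV_Plus_UNIV)
qed

lemma blockM_one: "blockM (mat 1) 0 0 (mat 1) = mat 1"
  unfolding vec_eq_iff
proof (intro allI)
  fix i j :: "'a + 'b"
  show "blockM (mat 1) 0 0 (mat 1) $ i $ j = (mat 1 :: complex^('a::finite+'b::finite)^('a+'b)) $ i $ j"
    by (cases i; cases j) (simp_all add: mat_def)
qed

lemma permutes_range_iff:
  "p permutes range f \<longleftrightarrow> p permutes UNIV \<and> (\<forall>i. i \<notin> range f \<longrightarrow> p i = i)"
  unfolding permutes_def by blast

text \<open>A row of \<open>M\<close> outside the range of \<open>f\<close> is an identity row, so
  only permutations fixing every index outside the range contribute. These correspond along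
  \<open>f\<close> to the permutations of \<open>'a\<close>, with equal sign.\<close>

lemma det_embed:
  fixes M :: "complex^'c^'c" and A :: "complex^'a^'a" and f :: "'a \<Rightarrow> 'c"
  assumes f: "inj f"
    and A: "\<And>a a'. M $ f a $ f a' = A $ a $ a'"
    and one: "\<And>i j. i \<notin> range f \<Longrightarrow> M $ i $ j = (if i = j then 1 else 0)"
  shows "det M = det A"
proof -
  let ?t = "\<lambda>p. of_int (sign p) * (\<Prod>i\<in>UNIV. M $ i $ p i)"
  let ?m = "map_permutation UNIV f" and ?n = "map_permutation (range f) (inv f)"
  have bij: "bij_betw f UNIV (range f)"
    using f by (simp add: bij_betw_def)
  have bij': "bij_betw (inv f) (range f) UNIV"
    using f by (simp add: bij_betw_def inj_on_inv_into image_image)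
  have "det M = (\<Sum>p | p permutes UNIV. ?t p)"
    by (simp add: det_def)
  also have "\<dots> = (\<Sum>p | p permutes range f. ?t p)"
  proof (rule sum.mono_neutral_right)
    show "finite {p. p permutes (UNIV :: 'c set)}" by (simp add: finite_permutations)
    show "{p. p permutes range f} \<subseteq> {p. p permutes UNIV}"
      by (auto simp: permutes_range_iff)
    show "\<forall>p\<in>{p. p permutes UNIV} - {p. p permutes range f}. ?t p = 0"
    proof
      fix p assume "p \<in> {p. p permutes UNIV} - {p. p permutes range f}"
      then obtain i where i: "i \<notin> range f" "p i \<noteq> i"
        by (auto simp: permutes_range_iff)
      then have "M $ i $ p i = 0"
        by (simp add: one)
      then have "(\<Prod>i\<in>UNIV. M $ i $ p i) = 0"
        by (metis UNIV_I finite_class.finite_UNIV prod_zero_iff)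
      then show "?t p = 0" by simp
    qed
  qed
  also have "\<dots> = (\<Sum>q | q permutes UNIV. of_int (sign q) * (\<Prod>a\<in>UNIV. A $ a $ q a))"
  proof (rule sum.reindex_bij_witness[where i = ?m and j = ?n])
    fix p assume p: "p \<in> {p. p permutes range f}"
    show q: "?n p \<in> {q. q permutes UNIV}"
      using map_permutation_permutes[OF bij'] p by blast
    show mq: "?m (?n p) = p"
      by (rule map_permutation_compose_inv[OF bij']) (use p f in \<open>auto simp: f_inv_into_f\<close>)
    define q where "q = ?n p"
    have p_eq: "p = ?m q" and qp: "q permutes UNIV"
      using mq q by (auto simp: q_def)
    have sign: "sign p = sign q"
      unfolding p_eq by (rule sign_map_permutation) (use qp f in auto)
    have pf: "p (f a) = f (q a)" for a
      unfolding p_eq by (rule map_permutation_apply) (use f in auto)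
    have "(\<Prod>i\<in>UNIV. M $ i $ p i) = (\<Prod>i\<in>range f. M $ i $ p i)"
      by (rule prod.mono_neutral_right) (use p in \<open>auto simp: one permutes_range_iff\<close>)
    also have "\<dots> = (\<Prod>a\<in>UNIV. A $ a $ q a)"
      by (subst prod.reindex) (use f in \<open>auto simp: pf A\<close>)
    finally show "of_int (sign (?n p)) * (\<Prod>a\<in>UNIV. A $ a $ ?n p a) = ?t p"
      by (simp add: q_def[symmetric] sign)
  next
    fix q assume q: "q \<in> {q. q permutes (UNIV :: 'a set)}"
    show "?m q \<in> {p. p permutes range f}"
      using map_permutation_permutes[OF bij] q by blast
    show "?n (?m q) = q"
      by (rule map_permutation_compose_inv[OF bij]) (use q f in auto)
  qed
  finally show ?thesis by (simp add: det_def)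
qed

lemma det_blockM_Inl: "det (blockM A 0 0 (mat 1) :: complex^('a::finite+'b::finite)^('a+'b)) = det A"
proof (rule det_embed[where f = Inl])
  fix i j :: "'a + 'b" assume "i \<notin> range Inl"
  then show "(blockM A 0 0 (mat 1) :: complex^('a::finite+'b::finite)^('a+'b)) $ i $ j = (if i = j then 1 else 0)"
    by (cases i; cases j) (auto simp: mat_def)
qed auto

lemma det_blockM_Inr: "det (blockM (mat 1) 0 0 D :: complex^('a::finite+'b::finite)^('a+'b)) = det D"
proof (rule det_embed[where f = Inr])
  fix i j :: "'a + 'b" assume "i \<notin> range Inr"
  then show "(blockM (mat 1) 0 0 D :: complex^('a::finite+'b::finite)^('a+'b)) $ i $ j = (if i = j then 1 else 0)"
    by (cases i; cases j) (auto simp: mat_def)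
qed auto

lemma det_blockM_diag: "det (blockM A 0 0 D :: complex^('a::finite+'b::finite)^('a+'b)) = det A * det D"
proof -
  have "blockM A 0 0 D = blockM A 0 0 (mat 1) ** blockM (mat 1) 0 0 D"
    by (simp add: blockM_mult)
  then show ?thesis
    by (simp add: det_mul det_blockM_Inl det_blockM_Inr)
qed

text \<open>A unipotent block matrix is conjugate to its own square, and its determinant is nonzero.\<close>

lemma det_blockM_unipotent_lower:
  "det (blockM (mat 1) 0 C (mat 1) :: complex^('a::finite+'b::finite)^('a+'b)) = 1"
proof -
  let ?u = "\<lambda>C. blockM (mat 1) 0 C (mat 1) :: complex^('a::finite+'b::finite)^('a+'b)"
  let ?d = "blockM (mat 1) 0 0 (mat 2) :: complex^('a::finite+'b::finite)^('a+'b)"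
  have two: "mat 2 ** C = C + C"
    by (simp add: vec_eq_iff matrix_matrix_mult_def mat_def if_distrib if_distribR
        cong: if_cong)
  have "?u C ** ?u (-C) = mat 1"
    by (simp add: blockM_mult blockM_one)
  then have nz: "det (?u C) \<noteq> 0"
    by (metis det_I det_mul mult_zero_left zero_neq_one)
  have "det (mat 2 :: complex^'b^'b) \<noteq> 0"
    by (subst det_diagonal) (auto simp: mat_def)
  then have d: "det ?d \<noteq> 0"
    by (simp add: det_blockM_Inr)
  have "?d ** ?u C = (?u C ** ?u C) ** ?d"
    by (simp add: blockM_mult two)
  then have "det (?d ** ?u C) = det ((?u C ** ?u C) ** ?d)"
    by (rule arg_cong)
  then have "det ?d * det (?u C) = det (?u C) * det (?u C) * det ?d"
    unfolding det_mul .
  then show ?thesis using nz d by simp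
qed

lemma det_blockM_unipotent_upper:
  "det (blockM (mat 1) B 0 (mat 1) :: complex^('a::finite+'b::finite)^('a+'b)) = 1"
proof -
  have "transpose (blockM (mat 1) B 0 (mat 1)) = blockM (mat 1) 0 (transpose B) (mat 1)"
    unfolding vec_eq_iff
  proof (intro allI)
    fix i j :: "'a + 'b"
    show "transpose (blockM (mat 1) B 0 (mat 1)) $ i $ j =
      blockM (mat 1) 0 (transpose B) (mat 1) $ i $ j"
      by (cases i; cases j) (auto simp: transpose_def mat_def)
  qed
  then show ?thesis
    by (metis det_blockM_unipotent_lower det_transpose)
qed

text \<open>Block LDU factorization, whose two unipotent outer factors have determinant 1.\<close>

lemma det_blockM_congruence:
  "det (blockM A (A ** B) (C ** A) (C ** A ** B + D)) = det A * det D"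
proof -
  have "blockM A (A ** B) (C ** A) (C ** A ** B + D) =
      blockM (mat 1) 0 C (mat 1) ** blockM A 0 0 D ** blockM (mat 1) B 0 (mat 1)"
    by (simp add: blockM_mult)
  then show ?thesis
    by (simp add: det_mul det_blockM_unipotent_lower det_blockM_unipotent_upper det_blockM_diag)
qed

text \<open>Block elimination with multiplier \<open>F\<close>. Characterizing \<open>F\<close> by
  an equation keeps the inverse of \<open>D\<close> out of the formula.\<close>

lemma det_blockM_Schur:
  assumes "F ** D = B"
  shows "det (blockM A B C D) = det (A - F ** C) * det D"
proof -
  have "blockM A B C D = blockM (mat 1) F 0 (mat 1) ** blockM (A - F ** C) 0 C D"
    by (simp add: blockM_mult assms)
  moreover have "blockM (A - F ** C) 0 C D = blockM (A - F ** C) 0 0 (mat 1) **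
     blockM (mat 1) 0 C (mat 1) ** blockM (mat 1) 0 0 D"
    by (simp add: blockM_mult)
  ultimately show ?thesis
    by (simp add: det_mul det_blockM_unipotent_lower det_blockM_unipotent_upper
        det_blockM_Inl det_blockM_Inr)
qed

text \<open>Sylvester's identity: both sides come from one block matrix, eliminated once along each
  diagonal block.\<close>

lemma det_one_plus_mult_commute:
  fixes A :: "complex^'a^'b"
  shows "det (mat 1 + A ** B) = det (mat 1 + B ** A)"
proof -
  have "det (blockM (mat 1) (- A) B (mat 1)) = det (mat 1 + A ** B)"
    by (subst det_blockM_Schur[where F = "- A"]) (simp_all add: matrix_mult_minus_left)
  moreover have "det (blockM (mat 1) (- A) B (mat 1)) = det (mat 1 + B ** A)"
    using det_blockM_congruence[of "mat 1" "-A" B "mat 1 + B ** A"]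
    by (simp add: matrix_mult_minus_right)
  ultimately show ?thesis by simp
qed


subsection \<open>Determinants of positive definite matrices\<close>

lemma continuous_on_det [continuous_intros]:
  fixes f :: "'a::topological_space \<Rightarrow> complex^'n^'n"
  assumes "continuous_on S f"
  shows "continuous_on S (\<lambda>x. det (f x))"
  unfolding det_def by (intro continuous_intros assms)

section \<open>Conjugate transposes, the standard Hermitian form and positivity\<close>

lemma cadj_nth [simp]: "cadj A $ i $ j = cnj (A $ j $ i)"
  by (simp add: cadj_def)

lemma cadj_cadj [simp]: "cadj (cadj A) = A"
  by (simp add: vec_eq_iff)

lemma cadj_one [simp]: "cadj (mat 1) = mat 1"
  by (simp add: vec_eq_iff mat_def)

lemma cadj_mult: "cadj (A ** B) = cadj B ** cadj A"
  by (simp add: vec_eq_iff matrix_matrix_mult_def mult.commute)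

lemma cadj_add: "cadj (A + B) = cadj A + cadj B"
  by (simp add: vec_eq_iff)

lemma cadj_diff: "cadj (A - B) = cadj A - cadj B"
  by (simp add: vec_eq_iff)

lemma cadj_scaleR: "cadj (c *\<^sub>R A) = c *\<^sub>R cadj A"
  by (simp add: vec_eq_iff)

lemma det_cadj: "det (cadj A) = cnj (det A)"
proof -
  have "det (cadj A) = det (\<chi> i j. cnj (A $ i $ j))"
    by (subst det_transpose[symmetric]) (simp add: cadj_def transpose_def)
  then show ?thesis by (simp add: det_def)
qed

definition cform :: "complex^'n \<Rightarrow> complex^'n \<Rightarrow> complex" where
  "cform x y = (\<Sum>i\<in>UNIV. cnj (x $ i) * y $ i)"

lemma pos_def_alt:
  "pos_def A \<longleftrightarrow> hermitian A \<and> (\<forall>x. x \<noteq> 0 \<longrightarrow> 0 < Re (cform x (A *v x)))"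
  by (simp add: pos_def_def cform_def)

lemma pos_semidef_alt:
  "pos_semidef A \<longleftrightarrow> hermitian A \<and> (\<forall>x. 0 \<le> Re (cform x (A *v x)))"
  by (simp add: pos_semidef_def cform_def)

lemma cform_0_right [simp]: "cform x 0 = 0"
  by (simp add: cform_def)

lemma cform_add_right: "cform x (y + z) = cform x y + cform x z"
  by (simp add: cform_def sum.distrib distrib_left)

lemma cform_scaleR_right: "cform x (c *\<^sub>R y) = c *\<^sub>R cform x y"
  by (simp add: cform_def scaleR_sum_right)

lemma cform_smult_right: "cform x (c *s y) = c * cform x y"
  by (simp add: cform_def sum_distrib_left mult.left_commute)

lemma cnj_cform: "cnj (cform x y) = cform y x"
  by (simp add: cform_def mult.commute)

lemma cform_matrix_right: "cform x (A *v y) = cform (cadj A *v x) y"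
proof -
  have "cform x (A *v y) = (\<Sum>i\<in>UNIV. \<Sum>j\<in>UNIV. cnj (x $ i) * (A $ i $ j * y $ j))"
    by (simp add: cform_def matrix_vector_mult_def sum_distrib_left)
  also have "\<dots> = (\<Sum>j\<in>UNIV. \<Sum>i\<in>UNIV. cnj (x $ i) * (A $ i $ j * y $ j))"
    by (rule sum.swap)
  also have "\<dots> = cform (cadj A *v x) y"
    by (simp add: cform_def matrix_vector_mult_def sum_distrib_left sum_distrib_right mult_ac)
  finally show ?thesis .
qed

lemma cform_self_pos: "x \<noteq> 0 \<Longrightarrow> 0 < Re (cform x x)"
proof -
  assume "x \<noteq> 0"
  then obtain i where i: "x $ i \<noteq> 0" by (auto simp: vec_eq_iff)
  have "Re (cform x x) = (\<Sum>i\<in>UNIV. (cmod (x $ i))\<^sup>2)"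
    by (simp add: cform_def cmod_power2) (simp add: power2_eq_square)
  also have "\<dots> > 0"
    by (rule sum_pos2[where i = i]) (use i in auto)
  finally show ?thesis .
qed

lemma cform_hermitian_real:
  assumes "hermitian A"
  shows "cform x (A *v x) = complex_of_real (Re (cform x (A *v x)))"
proof -
  have "cnj (cform x (A *v x)) = cform x (A *v x)"
    using assms by (metis cnj_cform cform_matrix_right hermitian_def)
  then show ?thesis by (metis Reals_cnj_iff of_real_Re)
qed

lemma pos_def_imp_pos_semidef: "pos_def A \<Longrightarrow> pos_semidef A"
  unfolding pos_def_alt pos_semidef_alt
proof (elim conjE, intro conjI allI)
  fix x assume "\<forall>x. x \<noteq> 0 \<longrightarrow> 0 < Re (cform x (A *v x))"
  then show "0 \<le> Re (cform x (A *v x))"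
    by (cases "x = 0") (auto simp: less_imp_le)
qed

lemma pos_def_one: "pos_def (mat 1)"
  by (simp add: pos_def_alt hermitian_def cform_self_pos)

lemma pos_def_add: "pos_def A \<Longrightarrow> pos_semidef B \<Longrightarrow> pos_def (A + B)"
  unfolding pos_def_alt pos_semidef_alt hermitian_def
  by (simp add: cadj_add matrix_vector_mult_add_rdistrib cform_add_right add_pos_nonneg)

lemma pos_semidef_add: "pos_semidef A \<Longrightarrow> pos_semidef B \<Longrightarrow> pos_semidef (A + B)"
  unfolding pos_semidef_alt hermitian_def
  by (simp add: cadj_add matrix_vector_mult_add_rdistrib cform_add_right)

lemma scaleR_matrix_vector: "(c *\<^sub>R A) *v x = c *\<^sub>R (A *v x)" for A :: "complex^'n^'m"
  by (simp add: vec_eq_iff matrix_vector_mult_def scaleR_sum_right)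

lemma pos_def_scaleR: "pos_def A \<Longrightarrow> 0 < c \<Longrightarrow> pos_def (c *\<^sub>R A)"
  unfolding pos_def_alt hermitian_def
  by (simp add: cadj_scaleR scaleR_matrix_vector cform_scaleR_right)

lemma pos_semidef_scaleR: "pos_semidef A \<Longrightarrow> 0 \<le> c \<Longrightarrow> pos_semidef (c *\<^sub>R A)"
  unfolding pos_semidef_alt hermitian_def
  by (simp add: cadj_scaleR scaleR_matrix_vector cform_scaleR_right)

lemma cform_congruence:
  "cform x ((T ** A ** cadj T) *v x) = cform (cadj T *v x) (A *v (cadj T *v x))"
  by (simp add: cform_matrix_right[of x T] matrix_vector_mul_assoc[symmetric])

lemma pos_semidef_congruence: "pos_semidef A \<Longrightarrow> pos_semidef (T ** A ** cadj T)"
  unfolding pos_semidef_alt cform_congruence hermitian_def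
  by (simp add: cadj_mult matrix_mul_assoc)

lemma det_eq_0_kernel:
  fixes A :: "complex^'n^'n"
  assumes "det A = 0"
  obtains x where "x \<noteq> 0" "A *v x = 0"
proof -
  have "\<not> invertible A" using assms by (simp add: invertible_det_nz)
  then show ?thesis
    using that by (metis invertible_left_inverse matrix_left_invertible_ker)
qed

lemma pos_def_det_nonzero:
  assumes "pos_def A" shows "det A \<noteq> 0"
proof
  assume "det A = 0"
  then obtain x where "x \<noteq> 0" "A *v x = 0"
    by (rule det_eq_0_kernel)
  then show False using assms by (auto simp: pos_def_alt)
qed

lemma hermitian_det_real: "hermitian A \<Longrightarrow> det A = complex_of_real (Re (det A))"
  by (metis det_cadj hermitian_def Reals_cnj_iff of_real_Re)

lemma pos_def_det: "pos_def A \<Longrightarrow> det A = complex_of_real (Re (det A))"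
  using hermitian_det_real by (auto simp: pos_def_def)

text \<open>The segment from the identity to \<open>A\<close> consists of positive definite
  matrices, whose determinants are real and nonzero. By the intermediate value theorem the sign
  cannot change from its value at the identity.\<close>

lemma pos_def_det_pos:
  assumes A: "pos_def A" shows "0 < Re (det A)"
proof (rule ccontr)
  assume neg: "\<not> 0 < Re (det A)"
  let ?A = "\<lambda>s::real. (1 - s) *\<^sub>R mat 1 + s *\<^sub>R A"
  have pd: "pos_def (?A s)" if "0 \<le> s" "s \<le> 1" for s
  proof (cases "s = 1")
    case False
    then show ?thesis using that A
      by (intro pos_def_add pos_def_scaleR pos_def_one pos_semidef_scaleR pos_def_imp_pos_semidef)
         auto
  qed (use A in simp)
  have "\<exists>s\<ge>0. s \<le> 1 \<and> Re (det (?A s)) = 0"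
  proof (rule IVT2')
    show "continuous_on {0..1} (\<lambda>s. Re (det (?A s)))"
      by (intro continuous_intros)
  qed (use neg in auto)
  then obtain s where "0 \<le> s" "s \<le> 1" "Re (det (?A s)) = 0" by blast
  then show False
    using pd[of s] pos_def_det[of "?A s"] pos_def_det_nonzero[of "?A s"] by simp
qed

section \<open>Monotonicity of the determinant under positive semidefinite perturbations\<close>

lemma det_pencil_poly:
  "poly (det (\<chi> i j. [:A $ i $ j, B $ i $ j:])) s = det (\<chi> i j. A $ i $ j + s * B $ i $ j)"
  for A B :: "complex^'n^'n"
  by (simp add: det_def poly_sum poly_prod)

text \<open>All roots of the polynomial \<open>s \<mapsto> det (A + s B)\<close> are negative reals.\<close>

lemma det_add_ge:
  fixes A B :: "complex^'n^'n"
  assumes A: "pos_def A" and B: "pos_semidef B"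
  shows "Re (det A) \<le> Re (det (A + B))"
proof -
  let ?L = "\<lambda>s. (\<chi> i j. A $ i $ j + s * B $ i $ j) :: complex^'n^'n"
  \<comment> \<open>The determinant of the pencil is a polynomial in \<open>s\<close>, so it splits
    into linear factors over the complex numbers. Its values at 0 and 1 are the two determinants to
    be compared.\<close>
  define p where "p = det (\<chi> i j. [:A $ i $ j, B $ i $ j:])"
  have p: "poly p s = det (?L s)" for s
    unfolding p_def by (rule det_pencil_poly)
  have root: "\<exists>t>0. s = - complex_of_real t" if s: "poly p s = 0" for s
  proof -
    obtain x where x: "x \<noteq> 0" "?L s *v x = 0"
      using s unfolding p by (rule det_eq_0_kernel)
    \<comment> \<open>Pairing the kernel vector \<open>x\<close> with its image under the pencil
      leaves a scalar equation \<open>a + s * b = 0\<close> with \<open>a\<close> positive and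
      \<open>b\<close> nonnegative.\<close>
    define a b where "a = Re (cform x (A *v x))" and "b = Re (cform x (B *v x))"
    have ab: "0 < a" "0 \<le> b"
      using A B x by (auto simp: a_def b_def pos_def_alt pos_semidef_alt)
    have "?L s *v x = A *v x + s *s (B *v x)"
      by (simp add: vec_eq_iff matrix_vector_mult_def distrib_right sum.distrib
          sum_distrib_left mult.assoc)
    then have "cform x (A *v x) + s * cform x (B *v x) = 0"
      by (metis x(2) cform_0_right cform_add_right cform_smult_right)
    then have eq: "of_real a + s * of_real b = 0"
      unfolding a_def b_def
      using A B cform_hermitian_real by (metis pos_def_def pos_semidef_def)
    then have "b \<noteq> 0" using ab by auto
    then have "s = - complex_of_real (a / b)"
      using eq by (simp add: field_simps eq_neg_iff_add_eq_0)
    then show ?thesis using ab \<open>b \<noteq> 0\<close> by (intro exI[of _ "a / b"]) auto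
  qed
  obtain r where r: "smult (lead_coeff p) (\<Prod>i<degree p. [:-r i, 1:]) = p"
    by (rule complex_poly_decompose')
  have val: "poly p s = lead_coeff p * (\<Prod>i<degree p. (s - r i))" for s
    by (subst (1) r[symmetric]) (simp add: poly_prod)
  have "\<exists>t>0. r i = - complex_of_real t" if "i < degree p" for i
  proof (rule root)
    show "poly p (r i) = 0" unfolding val using that by (auto simp: prod_zero_iff)
  qed
  then obtain t where t: "\<And>i. i < degree p \<Longrightarrow> 0 < t i \<and> r i = - complex_of_real (t i)"
    by metis
  \<comment> \<open>For a root \<open>r i = - t i\<close> one has
    \<open>1 - r i = (1 + 1 / t i) * (0 - r i)\<close>, so passing from 0 to 1 multiplies every
    factor by a number above 1.\<close>
  have "poly p 1 = lead_coeff p * (\<Prod>i<degree p. of_real (1 + 1 / t i) * (0 - r i))"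
    unfolding val by (intro arg_cong2[where f = "(*)"] prod.cong refl)
      (use t in \<open>fastforce simp: field_simps\<close>)
  also have "\<dots> = of_real (\<Prod>i<degree p. 1 + 1 / t i) * poly p 0"
    unfolding val prod.distrib of_real_prod by (simp only: mult_ac)
  finally have eq: "poly p 1 = of_real (\<Prod>i<degree p. 1 + 1 / t i) * poly p 0" .
  have L: "?L 0 = A" "?L 1 = A + B" by (simp_all add: vec_eq_iff)
  have "1 \<le> (\<Prod>i<degree p. 1 + 1 / t i)"
    by (rule prod_ge_1) (use t in \<open>auto simp: less_imp_le\<close>)
  then have "1 * Re (det A) \<le> (\<Prod>i<degree p. 1 + 1 / t i) * Re (det A)"
    using pos_def_det_pos[OF A] by (intro mult_right_mono) auto
  also have "\<dots> = Re (det (A + B))"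
    using eq unfolding p L by (simp del: of_real_prod)
  finally show ?thesis by simp
qed


section \<open>The determinant of \<open>Mmat\<close> and its lower bound over all inflation
  factors\<close>

lemma cadj_blockM: "cadj (blockM A B C D) = blockM (cadj A) (cadj C) (cadj B) (cadj D)"
  unfolding vec_eq_iff
proof (intro allI)
  fix i j :: "'a + 'b"
  show "cadj (blockM A B C D) $ i $ j = blockM (cadj A) (cadj C) (cadj B) (cadj D) $ i $ j"
    by (cases i; cases j) simp_all
qed

lemma det_Mmat_real:
  assumes "hermitian SX" "hermitian SS" "hermitian SZ"
  shows "det (Mmat SX SS SZ W H) = of_real (Re (det (Mmat SX SS SZ W H)))"
  by (rule hermitian_det_real)
     (use assms in \<open>simp add: hermitian_def Mmat_def cadj_blockM cadj_add cadj_mult matrix_mul_assoc\<close>)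

text \<open>For \<open>W = mat 1\<close> the blocks fit the pattern of
  \<open>det_blockM_congruence\<close>, and the dependence on the channel disappears.\<close>

lemma det_Mmat_identity: "det (Mmat SX SS SZ (mat 1) H) = det (SX + SS) * det SZ"
  using det_blockM_congruence[of "SX + SS" "cadj H" H SZ] by (simp add: Mmat_def)

text \<open>\<open>|M(W,H)| / |H (\<Sigma>X + \<Sigma>S) H* + \<Sigma>Z|\<close> is the determinant of the covariance of \<open>U - F Y\<close> for the
  best linear estimator \<open>F\<close> of \<open>U\<close>; it dominates the error covariance of estimating \<open>X\<close> from
  \<open>H X + Z\<close>, which is the situation where \<open>S\<close> is known to the receiver.\<close>

lemma det_Mmat_lower_bound:
  fixes SX SS W :: "complex^'t^'t" and SZ :: "complex^'r^'r" and H :: "complex^'t^'r"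
  assumes SX: "pos_def SX" and SS: "pos_semidef SS" and SZ: "pos_def SZ"
  shows "Re (det SX) * Re (det SZ) * Re (det (H ** (SX + SS) ** cadj H + SZ))
    \<le> Re (det (Mmat SX SS SZ W H)) * Re (det (SZ + H ** SX ** cadj H))"
proof -
  define D0 where "D0 = SZ + H ** SX ** cadj H"
  define D where "D = H ** (SX + SS) ** cadj H + SZ"
  define B where "B = (SX + W ** SS) ** cadj H"
  define C where "C = H ** (SX + SS ** cadj W)"
  have herm: "cadj SX = SX" "cadj SS = SS" "cadj SZ = SZ"
    using SX SS SZ by (auto simp: pos_def_def pos_semidef_def hermitian_def)
  have D0: "pos_def D0"
    unfolding D0_def using SX SZ
    by (intro pos_def_add pos_semidef_congruence pos_def_imp_pos_semidef)
  have D_eq: "D = D0 + H ** SS ** cadj H"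
    by (simp add: D_def D0_def matrix_add_ldistrib matrix_add_rdistrib)
  have D: "pos_def D"
    unfolding D_eq using D0 SS by (intro pos_def_add pos_semidef_congruence)
  obtain F0' where F0': "F0' ** D0 = mat 1"
    using pos_def_det_nonzero[OF D0] by (metis invertible_det_nz invertible_left_inverse)
  obtain F' where F': "F' ** D = mat 1"
    using pos_def_det_nonzero[OF D] by (metis invertible_det_nz invertible_left_inverse)
  \<comment> \<open>\<open>F0\<close> is the best linear estimator of X from HX + Z, whose
    covariance is \<open>D0\<close>, and \<open>F\<close> that of U from Y, whose covariance is
    \<open>D\<close>.\<close>
  define F0 where "F0 = SX ** cadj H ** F0'"
  define F where "F = B ** F'"
  have F0D: "F0 ** D0 = SX ** cadj H"
    by (simp add: F0_def F0' matrix_mul_assoc[symmetric])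
  have FD: "F ** D = B"
    by (simp add: F_def F' matrix_mul_assoc[symmetric])
  have cD: "cadj D = D" "cadj D0 = D0"
    using D D0 by (auto simp: pos_def_def hermitian_def)
  have DF0: "D0 ** cadj F0 = H ** SX"
    using arg_cong[OF F0D, of cadj] by (simp add: cadj_mult cD herm)
  have DF: "D ** cadj F = C"
    using arg_cong[OF FD, of cadj]
    by (simp add: cadj_mult cadj_add cD herm B_def C_def matrix_mul_assoc)
  define N where "N = SX - F0 ** H ** SX"
  have N_alt: "N = SX - F0 ** D0 ** cadj F0"
    by (simp add: N_def DF0 matrix_mul_assoc[symmetric])
  \<comment> \<open>The estimation error is (I - F0 H) X - F0 Z with X and Z independent, so its
    covariance is a sum of two positive semidefinite terms.\<close>
  have N_sum: "N = (mat 1 - F0 ** H) ** SX ** cadj (mat 1 - F0 ** H) + F0 ** SZ ** cadj F0"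
  proof -
    have "F0 ** SZ ** cadj F0 = F0 ** D0 ** cadj F0 - F0 ** (H ** SX ** cadj H) ** cadj F0"
      by (simp add: D0_def matrix_add_ldistrib matrix_add_rdistrib)
    moreover have "F0 ** D0 ** cadj F0 = F0 ** H ** SX"
      by (simp add: DF0 matrix_mul_assoc[symmetric])
    moreover have "F0 ** D0 ** cadj F0 = SX ** cadj H ** cadj F0"
      by (simp add: F0D)
    ultimately show ?thesis
      by (simp add: N_def cadj_diff cadj_mult matrix_diff_ldistrib matrix_diff_rdistrib
          matrix_mul_assoc)
  qed
  have N: "pos_def N"
    unfolding pos_def_alt
  proof (intro conjI allI impI)
    show "hermitian N"
      by (simp add: hermitian_def N_alt cadj_diff cadj_mult cD herm matrix_mul_assoc)
    fix x :: "complex^'t" assume x: "x \<noteq> 0"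
    let ?a = "cadj (mat 1 - F0 ** H) *v x" and ?b = "cadj F0 *v x"
    have form: "cform x (N *v x) = cform ?a (SX *v ?a) + cform ?b (SZ *v ?b)"
      unfolding N_sum matrix_vector_mult_add_rdistrib cform_add_right cform_congruence ..
    \<comment> \<open>This excludes that \<open>?a\<close> and \<open>?b\<close> both vanish, so one
      of the two nonnegative terms is strictly positive.\<close>
    have "x = ?a + cadj H *v ?b"
      by (simp add: cadj_diff cadj_mult matrix_vector_mult_diff_rdistrib
          matrix_vector_mul_assoc[symmetric])
    then have "?a \<noteq> 0 \<or> ?b \<noteq> 0"
      using x by (metis add.right_neutral matrix_vector_mult_0_right)
    then show "0 < Re (cform x (N *v x))"
      unfolding form using SX SZ pos_def_imp_pos_semidef[OF SX] pos_def_imp_pos_semidef[OF SZ]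
      by (auto simp: pos_def_alt pos_semidef_alt intro: add_pos_nonneg add_nonneg_pos)
  qed
  \<comment> \<open>Two evaluations of the determinant of the joint covariance of X and HX +
    Z.\<close>
  have detN: "det N * det D0 = det SX * det SZ"
    using det_blockM_Schur[OF F0D, of SX "H ** SX"] det_blockM_congruence[of SX "cadj H" H SZ]
    by (simp add: N_def D0_def matrix_mul_assoc add.commute)
  define S where "S = SX + W ** SS ** cadj W - F ** C"
  have detM: "det (Mmat SX SS SZ W H) = det S * det D"
    unfolding Mmat_def S_def C_def[symmetric] D_def[symmetric] B_def[symmetric]
    by (rule det_blockM_Schur[OF FD])
  \<comment> \<open>With T = HX + Z, the error U - F Y equals (X - F0 T) - (F - F0) T + (W - F H) S.
    The three summands are uncorrelated, with covariances \<open>N\<close>, \<open>G\<close> and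
    \<open>E\<close>.\<close>
  define E where "E = (W - F ** H) ** SS ** cadj (W - F ** H)"
  define G where "G = (F - F0) ** D0 ** cadj (F - F0)"
  have S_eq: "S = N + (E + G)"
  proof -
    have FC: "F ** C = F ** D ** cadj F"
      by (simp add: DF matrix_mul_assoc[symmetric])
    have BF: "F ** D ** cadj F = SX ** cadj H ** cadj F + W ** SS ** cadj H ** cadj F"
      by (simp add: FD B_def matrix_add_rdistrib)
    have CF: "F ** D ** cadj F = F ** H ** SX + F ** H ** SS ** cadj W"
      by (simp only: FC[symmetric] C_def) (simp add: matrix_add_ldistrib matrix_mul_assoc)
    have FDF: "F ** D ** cadj F = F ** D0 ** cadj F + F ** H ** SS ** cadj H ** cadj F"
      by (simp add: D_eq matrix_add_ldistrib matrix_add_rdistrib matrix_mul_assoc)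
    have E: "E = W ** SS ** cadj W - W ** SS ** cadj H ** cadj F - F ** H ** SS ** cadj W
        + F ** H ** SS ** cadj H ** cadj F"
      by (simp add: E_def cadj_diff cadj_mult matrix_diff_ldistrib matrix_diff_rdistrib
          matrix_mul_assoc)
    have FD0F0: "F ** D0 ** cadj F0 = F ** H ** SX"
      by (simp add: DF0 matrix_mul_assoc[symmetric])
    have G: "G = F ** D0 ** cadj F - SX ** cadj H ** cadj F - F ** H ** SX
        + F0 ** D0 ** cadj F0"
      by (simp add: G_def cadj_diff matrix_diff_ldistrib matrix_diff_rdistrib F0D FD0F0)
    \<comment> \<open>The same matrix is added twice and subtracted once so that each copy can be
      expanded differently: through \<open>B\<close>, through \<open>C\<close>, and through the
      decomposition of \<open>D\<close>.\<close>
    have "F ** C = F ** D ** cadj F + F ** D ** cadj F - F ** D ** cadj F"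
      by (simp add: FC)
    also have "\<dots> = (SX ** cadj H ** cadj F + W ** SS ** cadj H ** cadj F)
        + (F ** H ** SX + F ** H ** SS ** cadj W)
        - (F ** D0 ** cadj F + F ** H ** SS ** cadj H ** cadj F)"
      by (simp only: BF[symmetric] CF[symmetric] FDF[symmetric])
    finally show ?thesis
      unfolding S_def N_alt E G by (simp add: algebra_simps)
  qed
  have "Re (det N) \<le> Re (det S)"
    unfolding S_eq E_def G_def using N SS pos_def_imp_pos_semidef[OF D0]
    by (intro det_add_ge pos_semidef_add pos_semidef_congruence)
  then have "Re (det N) * Re (det D) * Re (det D0) \<le> Re (det S) * Re (det D) * Re (det D0)"
    using pos_def_det_pos[OF D] pos_def_det_pos[OF D0] by (intro mult_right_mono) auto
  moreover have "Re (det N) * Re (det D0) = Re (det SX) * Re (det SZ)"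
    using arg_cong[OF detN, of Re] pos_def_det[OF D0] pos_def_det[OF SZ]
    by (metis Re_complex_of_real of_real_mult pos_def_det[OF N] pos_def_det[OF SX])
  moreover have "Re (det (Mmat SX SS SZ W H)) = Re (det S) * Re (det D)"
  proof -
    have "Im (det D) = 0"
      using pos_def_det[OF D] by (metis Im_complex_of_real)
    then show ?thesis unfolding detM by simp
  qed
  ultimately show ?thesis
    unfolding D_def[symmetric] D0_def[symmetric] by (metis mult.assoc mult.commute)
qed

subsection \<open>High-power asymptotics of determinants\<close>

text \<open>Rank \<open>CARD('t)\<close> makes the rows span the whole space, which amounts to a
  left inverse.\<close>

lemma full_rank_kernel:
  fixes H :: "complex^'t^'r"
  assumes "rank H = CARD('t)" "H *v x = 0"
  shows "x = 0"
proof -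
  have "vec.span (rows H) = UNIV"
    using assms(1) unfolding row_rank_def_gen
    by (simp add: vec.dim_eq_full[symmetric] vec.dimension_def card_cart_basis)
  then show ?thesis
    using assms(2) matrix_left_invertible_span_rows_gen[of H] matrix_left_invertible_ker[of H]
    by blast
qed

lemma det_scaleR: "det (c *\<^sub>R A) = of_real c ^ CARD('n) * det A" for A :: "complex^'n^'n"
proof -
  have "c *\<^sub>R A = (\<chi> i. of_real c *s (A $ i))"
    by (simp add: vec_eq_iff) (simp add: scaleR_conv_of_real)
  then show ?thesis
    using det_rows_mul[of "\<lambda>_. of_real c" "\<lambda>i. A $ i"] by simp
qed

lemma Re_det_scaleR: "Re (det (c *\<^sub>R A)) = c ^ CARD('n) * Re (det A)" for A :: "complex^'n^'n"
  unfolding det_scaleR by (simp flip: of_real_power)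

lemma scaleR_matrix_mult: "(c *\<^sub>R A) ** B = c *\<^sub>R (A ** B)" for A :: "complex^'n^'m"
  by (simp add: vec_eq_iff matrix_matrix_mult_def scaleR_sum_right)

text \<open>Sylvester's identity moves the determinant to size t, where the power P^t factors out.
  The remainder is continuous in 1/P, including at 0.\<close>

lemma det_noise_plus_signal_asymptotics:
  fixes SZ Zi :: "complex^'r^'r" and A :: "complex^'t^'t" and H :: "complex^'t^'r"
  assumes Zi: "SZ ** Zi = mat 1"
  shows "((\<lambda>P::real. det (SZ + H ** (P *\<^sub>R A) ** cadj H) / of_real P ^ CARD('t))
     \<longlongrightarrow> det SZ * (det A * det (cadj H ** Zi ** H))) at_top"
proof -
  let ?G = "cadj H ** Zi ** H"
  have eq: "det (SZ + H ** (P *\<^sub>R A) ** cadj H) / of_real P ^ CARD('t)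
      = det SZ * det (inverse P *\<^sub>R mat 1 + A ** ?G)" if "0 < P" for P :: real
  proof -
    have "SZ + H ** (P *\<^sub>R A) ** cadj H
        = SZ ** (mat 1 + (Zi ** H) ** ((P *\<^sub>R A) ** cadj H))"
      by (simp add: matrix_add_ldistrib matrix_mul_assoc Zi)
    then have "det (SZ + H ** (P *\<^sub>R A) ** cadj H)
        = det SZ * det (mat 1 + ((P *\<^sub>R A) ** cadj H) ** (Zi ** H))"
      by (simp only: det_mul det_one_plus_mult_commute[of "Zi ** H"])
    also have "mat 1 + ((P *\<^sub>R A) ** cadj H) ** (Zi ** H)
        = P *\<^sub>R (inverse P *\<^sub>R mat 1 + A ** ?G)"
      using that by (simp add: scaleR_matrix_mult matrix_mul_assoc scaleR_add_right)
    finally show ?thesis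
      using that by (simp add: det_scaleR)
  qed
  have "continuous_on UNIV (\<lambda>s::real. det SZ * det (s *\<^sub>R mat 1 + A ** ?G))"
    by (intro continuous_intros)
  then have "isCont (\<lambda>s::real. det SZ * det (s *\<^sub>R mat 1 + A ** ?G)) 0"
    by (simp add: continuous_on_eq_continuous_at)
  then have "((\<lambda>s::real. det SZ * det (s *\<^sub>R mat 1 + A ** ?G)) \<longlongrightarrow>
      det SZ * det (0 *\<^sub>R mat 1 + A ** ?G)) (at 0)"
    by (simp only: isCont_def)
  then have "((\<lambda>s. det SZ * det (s *\<^sub>R mat 1 + A ** ?G)) \<longlongrightarrow>
      det SZ * (det A * det ?G)) (at_right (0::real))"
    by (simp add: filterlim_at_split det_mul)
  then have "((\<lambda>P. det SZ * det (inverse P *\<^sub>R mat 1 + A ** ?G)) \<longlongrightarrow>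
      det SZ * (det A * det ?G)) (at_top :: real filter)"
    by (rule filterlim_compose) (rule filterlim_inverse_at_right_top)
  then show ?thesis
    by (rule Lim_transform_eventually)
       (use eventually_gt_at_top[of "0::real"] in \<open>eventually_elim, simp add: eq\<close>)
qed

lemma det_ratio_tendsto:
  fixes SZ :: "complex^'r^'r" and A B :: "complex^'t^'t" and H :: "complex^'t^'r"
  assumes SZ: "pos_def SZ" and A: "pos_def A" and B: "pos_def B" and H: "rank H = CARD('t)"
  shows "((\<lambda>P::real. Re (det (SZ + H ** (P *\<^sub>R A) ** cadj H)) /
      Re (det (SZ + H ** (P *\<^sub>R B) ** cadj H)))
     \<longlongrightarrow> Re (det A) / Re (det B)) at_top"
proof -
  obtain Zi where Zi: "SZ ** Zi = mat 1"
    using pos_def_det_nonzero[OF SZ] by (metis invertible_det_nz invertible_right_inverse)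
  let ?G = "cadj H ** Zi ** H"
  \<comment> \<open>The factor common to numerator and denominator must be nonzero before it
    cancels. If \<open>?G\<close> kills \<open>x\<close>, then \<open>y = Zi *v (H *v x)\<close>
    satisfies \<open>cform y (SZ *v y) = 0\<close>, hence \<open>y = 0\<close> and
    \<open>H *v x = 0\<close>, against full rank.\<close>
  have g: "det ?G \<noteq> 0"
  proof
    assume "det ?G = 0"
    then obtain x where x: "x \<noteq> 0" "?G *v x = 0"
      by (rule det_eq_0_kernel)
    define y where "y = Zi *v (H *v x)"
    have Hx: "SZ *v y = H *v x"
      by (simp add: y_def matrix_vector_mul_assoc matrix_mul_assoc Zi)
    have "0 = cform x (cadj H *v y)"
      using x(2) by (simp add: y_def matrix_vector_mul_assoc matrix_mul_assoc)
    also have "\<dots> = cform (SZ *v y) y"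
      by (simp add: cform_matrix_right Hx)
    also have "\<dots> = cform y (SZ *v y)"
      using SZ by (simp add: cform_matrix_right pos_def_def hermitian_def)
    finally have "y = 0"
      using SZ by (force simp: pos_def_alt)
    then have "H *v x = 0" using Hx by simp
    then show False using full_rank_kernel[OF H] x(1) by blast
  qed
  let ?d = "\<lambda>A P. det (SZ + H ** (P *\<^sub>R A) ** cadj H)"
  have nz: "det SZ * (det B * det ?G) \<noteq> 0"
    using g pos_def_det_nonzero[OF SZ] pos_def_det_nonzero[OF B] by simp
  have "((\<lambda>P::real. (?d A P / of_real P ^ CARD('t)) / (?d B P / of_real P ^ CARD('t)))
     \<longlongrightarrow> (det SZ * (det A * det ?G)) / (det SZ * (det B * det ?G))) at_top"
    by (intro tendsto_divide det_noise_plus_signal_asymptotics Zi nz)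
  moreover have "(det SZ * (det A * det ?G)) / (det SZ * (det B * det ?G)) = det A / det B"
    using nz by simp
  moreover have "\<forall>\<^sub>F P::real in at_top.
      (?d A P / of_real P ^ CARD('t)) / (?d B P / of_real P ^ CARD('t)) = ?d A P / ?d B P"
    using eventually_gt_at_top[of 0] by eventually_elim simp
  ultimately have lim: "((\<lambda>P. ?d A P / ?d B P) \<longlongrightarrow> det A / det B) at_top"
    by (auto elim: Lim_transform_eventually)
  have real: "?d C P = of_real (Re (?d C P))" if "pos_def C" "0 < P" for C P
    using that SZ
    by (intro pos_def_det pos_def_add pos_semidef_congruence pos_def_imp_pos_semidef pos_def_scaleR)
  have "((\<lambda>P. Re (?d A P / ?d B P)) \<longlongrightarrow> Re (det A / det B)) at_top"
    by (rule tendsto_Re[OF lim])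
  moreover have "Re (det A / det B) = Re (det A) / Re (det B)"
    by (subst pos_def_det[OF A], subst pos_def_det[OF B]) (simp flip: of_real_divide)
  moreover have "\<forall>\<^sub>F P in at_top. Re (?d A P / ?d B P) = Re (?d A P) / Re (?d B P)"
    using eventually_gt_at_top[of 0]
  proof eventually_elim
    case (elim P)
    show ?case
      by (subst real[OF A elim], subst real[OF B elim]) (simp flip: of_real_divide)
  qed
  ultimately show ?thesis
    by (auto elim: Lim_transform_eventually)
qed

subsection \<open>Separable functions and interpolation\<close>

text \<open>Polynomial growth is measured in powers of \<open>1 + (norm y)\<^sup>2\<close> because
  its logarithm is then controlled by the second moment.\<close>

definition tempered :: "('b::real_normed_vector \<Rightarrow> complex) \<Rightarrow> bool" where
  "tempered v \<longleftrightarrow> continuous_on UNIV v \<and> (\<exists>c k. 0 \<le> c \<and> (\<forall>y. cmod (v y) \<le> c * (1 + (norm y)\<^sup>2) ^ k))"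

lemma tempered_const: "tempered (\<lambda>_. a)"
  unfolding tempered_def
  by (intro conjI exI[of _ "cmod a"] exI[of _ "0::nat"]) auto

lemma tempered_mult:
  assumes "tempered f" "tempered g" shows "tempered (\<lambda>y. f y * g y)"
proof -
  obtain c k d l where c: "0 \<le> c" "\<And>y. cmod (f y) \<le> c * (1 + (norm y)\<^sup>2) ^ k"
    and d: "0 \<le> d" "\<And>y. cmod (g y) \<le> d * (1 + (norm y)\<^sup>2) ^ l"
    using assms unfolding tempered_def by metis
  have "cmod (f y * g y) \<le> (c * d) * (1 + (norm y)\<^sup>2) ^ (k + l)" for y
    using mult_mono[OF c(2) d(2)] c(1) by (simp add: norm_mult power_add mult_ac)
  with assms c(1) d(1) show ?thesis
    unfolding tempered_def by (auto intro!: continuous_intros exI[of _ "c * d"])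
qed

lemma tempered_add:
  assumes "tempered f" "tempered g" shows "tempered (\<lambda>y. f y + g y)"
proof -
  obtain c k d l where c: "0 \<le> c" "\<And>y. cmod (f y) \<le> c * (1 + (norm y)\<^sup>2) ^ k"
    and d: "0 \<le> d" "\<And>y. cmod (g y) \<le> d * (1 + (norm y)\<^sup>2) ^ l"
    using assms unfolding tempered_def by metis
  have "cmod (f y + g y) \<le> (c + d) * (1 + (norm y)\<^sup>2) ^ (k + l)" for y
  proof -
    have "cmod (f y) \<le> c * (1 + (norm y)\<^sup>2) ^ (k + l)" "cmod (g y) \<le> d * (1 + (norm y)\<^sup>2) ^ (k + l)"
      using c d by (auto intro!: order_trans[OF c(2)] order_trans[OF d(2)] mult_left_mono power_increasing)
    then show ?thesis
      using norm_triangle_ineq[of "f y" "g y"] by (simp add: distrib_right)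
  qed
  with assms c(1) d(1) show ?thesis
    unfolding tempered_def by (auto intro!: continuous_intros exI[of _ "c + d"])
qed

lemma tempered_cnj: "tempered f \<Longrightarrow> tempered (\<lambda>y. cnj (f y))"
  unfolding tempered_def by (auto intro: continuous_intros)

lemma tempered_entry: "tempered (\<lambda>H :: complex^'t^'r. H $ i $ j)"
proof -
  have "cmod (H $ i $ j) \<le> 1 * (1 + (norm H)\<^sup>2) ^ 1" for H :: "complex^'t^'r"
  proof -
    have "cmod (H $ i $ j) \<le> norm H"
      by (rule order_trans[OF Finite_Cartesian_Product.norm_nth_le Finite_Cartesian_Product.norm_nth_le])
    also have "\<dots> \<le> 1 + (norm H)\<^sup>2"
      using zero_le_power2[of "norm H - 1"] norm_ge_zero[of H]
      unfolding power2_diff one_power2 by linarith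
    finally show ?thesis by simp
  qed
  then show ?thesis
    unfolding tempered_def by (intro conjI exI[of _ 1] continuous_intros) auto
qed

text \<open>The left argument will be the inflation factor and the right one the channel. The
  inductive form reduces closure properties to the two generating rules.\<close>

inductive separable :: "('a::topological_space \<Rightarrow> 'b::real_normed_vector \<Rightarrow> complex) \<Rightarrow> bool" where
  separable_product: "continuous_on UNIV u \<Longrightarrow> tempered v \<Longrightarrow> separable (\<lambda>x y. u x * v y)"
| separable_add: "separable f \<Longrightarrow> separable g \<Longrightarrow> separable (\<lambda>x y. f x y + g x y)"

lemma separable_continuous: "continuous_on UNIV u \<Longrightarrow> separable (\<lambda>x y. u x)"
  using separable_product[of u "\<lambda>_. 1"] by (simp add: tempered_const)

lemma separable_tempered: "tempered v \<Longrightarrow> separable (\<lambda>x y. v y)"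
  using separable_product[of "\<lambda>_. 1" v] by simp

lemma separable_mult: "separable f \<Longrightarrow> separable g \<Longrightarrow> separable (\<lambda>x y. f x y * g x y)"
proof (induction rule: separable.induct)
  case (separable_product u v)
  from separable_product.prems show ?case
  proof (induction rule: separable.induct)
    case (separable_product u' v')
    have "separable (\<lambda>x y. (u x * u' x) * (v y * v' y))"
      using separable_product \<open>continuous_on UNIV u\<close> \<open>tempered v\<close>
      by (intro separable.separable_product tempered_mult continuous_intros)
    then show ?case by (simp add: mult_ac)
  next
    case (separable_add f g)
    then show ?case
      using separable.separable_add by (simp add: distrib_left)
  qed
next
  case (separable_add f f')
  then show ?case
    using separable.separable_add by (simp add: distrib_right)
qed

lemma separable_cnj: "separable f \<Longrightarrow> separable (\<lambda>x y. cnj (f x y))"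
proof (induction rule: separable.induct)
  case (separable_product u v)
  then show ?case
    using separable.separable_product[of "\<lambda>x. cnj (u x)" "\<lambda>y. cnj (v y)"]
    by (simp add: tempered_cnj continuous_intros)
next
  case (separable_add f g)
  then show ?case by (simp add: separable.separable_add)
qed

lemma separable_const: "separable (\<lambda>x y. a)"
  by (intro separable_continuous continuous_intros)

lemma separable_sum: "(\<And>i. i \<in> I \<Longrightarrow> separable (f i)) \<Longrightarrow> separable (\<lambda>x y. \<Sum>i\<in>I. f i x y)"
  by (induction I rule: infinite_finite_induct) (auto intro: separable_const separable_add)

lemma separable_prod: "(\<And>i. i \<in> I \<Longrightarrow> separable (f i)) \<Longrightarrow> separable (\<lambda>x y. \<Prod>i\<in>I. f i x y)"
  by (induction I rule: infinite_finite_induct) (auto intro: separable_const separable_mult)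

lemma separable_tempered_right: "separable f \<Longrightarrow> tempered (f x)"
  by (induction rule: separable.induct) (auto intro: tempered_mult tempered_const tempered_add)

lemma separable_continuous_left: "separable f \<Longrightarrow> continuous_on UNIV (\<lambda>x. f x y)"
  by (induction rule: separable.induct) (auto intro: continuous_intros)

text \<open>Induction on the list: a new function is either reproduced by the present nodes already,
  or its residual \<open>h\<close> is nonzero at some point, which then becomes a further
  node.\<close>

lemma interpolation_functions:
  fixes us :: "('a::topological_space \<Rightarrow> complex) list"
  assumes "\<And>u. u \<in> set us \<Longrightarrow> continuous_on UNIV u"
  shows "\<exists>(n::nat) l p. (\<forall>i<n. continuous_on UNIV (l i)) \<and>
     (\<forall>u\<in>set us. \<forall>x. u x = (\<Sum>i<n. l i x * u (p i)))"
  using assms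
proof (induction us)
  case Nil
  then show ?case by (intro exI[of _ 0]) auto
next
  case (Cons m us)
  have "\<exists>(n::nat) l p. (\<forall>i<n. continuous_on UNIV (l i)) \<and>
     (\<forall>u\<in>set us. \<forall>x. u x = (\<Sum>i<n. l i x * u (p i)))"
    by (rule Cons.IH) (use Cons.prems in simp)
  then obtain n :: nat and l p where l: "\<And>i. i < n \<Longrightarrow> continuous_on UNIV (l i)"
    and us: "\<And>u x. u \<in> set us \<Longrightarrow> u x = (\<Sum>i<n. l i x * u (p i))"
    by blast
  define h where "h x = m x - (\<Sum>i<n. l i x * m (p i))" for x
  have h_cont: "continuous_on UNIV h"
    unfolding h_def using Cons.prems l by (intro continuous_intros) auto
  show ?case
  proof (cases "\<forall>x. h x = 0")
    case True
    then have "m x = (\<Sum>i<n. l i x * m (p i))" for x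
      using h_def[of x] by (metis eq_iff_diff_eq_0)
    then have "\<forall>u\<in>set (m # us). \<forall>x. u x = (\<Sum>i<n. l i x * u (p i))"
      using us unfolding set_simps by blast
    then show ?thesis using l by blast
  next
    case False
    then obtain x0 where x0: "h x0 \<noteq> 0" by blast
    \<comment> \<open>The new basis function \<open>h / h x0\<close> carries the value at
      \<open>x0\<close>, and the old ones are corrected so that the formula adds only the error at
      \<open>x0\<close>. This error is zero for the earlier functions and \<open>h x0\<close> for
      \<open>m\<close>.\<close>
    define l' where "l' i x = (if i < n then l i x - l i x0 * (h x / h x0) else h x / h x0)" for i x
    define p' where "p' i = (if i < n then p i else x0)" for i
    have cont: "continuous_on UNIV (l' i)" for i
      unfolding l'_def using l h_cont x0
      by (cases "i < n") (auto intro!: continuous_intros)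
    have expand: "(\<Sum>i<Suc n. l' i x * u (p' i)) =
        (\<Sum>i<n. l i x * u (p i)) + h x / h x0 * (u x0 - (\<Sum>i<n. l i x0 * u (p i)))" for u x
    proof -
      have "(\<Sum>i<n. l' i x * u (p' i)) = (\<Sum>i<n. l i x * u (p i) - h x / h x0 * (l i x0 * u (p i)))"
        by (rule sum.cong) (auto simp: l'_def p'_def algebra_simps)
      then show ?thesis
        by (simp add: sum_subtractf sum_distrib_left sum_divide_distrib l'_def p'_def algebra_simps)
    qed
    have "u x = (\<Sum>i<Suc n. l' i x * u (p' i))" if "u \<in> set (m # us)" for u x
    proof (cases "u = m")
      case True
      have "m x0 - (\<Sum>i<n. l i x0 * m (p i)) = h x0" "m x = (\<Sum>i<n. l i x * m (p i)) + h x"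
        by (simp_all add: h_def)
      then show ?thesis unfolding expand True using x0 by simp
    next
      case False
      then have "u \<in> set us" using that by simp
      from us[OF this, of x] us[OF this, of x0] show ?thesis
        unfolding expand by (metis add.right_neutral eq_iff_diff_eq_0 mult_zero_right)
    qed
    then show ?thesis using cont by blast
  qed
qed

lemma separable_list:
  "separable f \<Longrightarrow> \<exists>ws. (\<forall>w\<in>set ws. continuous_on UNIV (fst w)) \<and>
     (\<forall>x y. f x y = (\<Sum>w\<leftarrow>ws. fst w x * snd w y))"
proof (induction rule: separable.induct)
  case (separable_product u v)
  then show ?case by (intro exI[of _ "[(u, v)]"]) auto
next
  case (separable_add f g)
  then obtain ws ws' where "\<forall>w\<in>set ws. continuous_on UNIV (fst w)"
      "\<forall>x y. f x y = (\<Sum>w\<leftarrow>ws. fst w x * snd w y)"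
      "\<forall>w\<in>set ws'. continuous_on UNIV (fst w)"
      "\<forall>x y. g x y = (\<Sum>w\<leftarrow>ws'. fst w x * snd w y)" by blast
  then show ?case by (intro exI[of _ "ws @ ws'"]) auto
qed

text \<open>It suffices to interpolate the left factors: nodes and coefficients are shared by all
  summands, so they pull out of the sum.\<close>

lemma separable_interpolation:
  assumes "separable f"
  obtains n l p where "\<And>i. i < n \<Longrightarrow> continuous_on UNIV (l i)"
    "\<And>x y. f x y = (\<Sum>i<n::nat. l i x * f (p i) y)"
proof -
  obtain ws where ws: "\<forall>w\<in>set ws. continuous_on UNIV (fst w)"
      "\<And>x y. f x y = (\<Sum>w\<leftarrow>ws. fst w x * snd w y)"
    using separable_list[OF assms] by blast
  have "\<exists>(n::nat) l p. (\<forall>i<n. continuous_on UNIV (l i)) \<and>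
     (\<forall>u\<in>set (map fst ws). \<forall>x. u x = (\<Sum>i<n. l i x * u (p i)))"
    by (rule interpolation_functions) (use ws(1) in auto)
  then obtain n :: nat and l p where l: "\<And>i. i < n \<Longrightarrow> continuous_on UNIV (l i)"
    and u': "\<And>u x. u \<in> set (map fst ws) \<Longrightarrow> u x = (\<Sum>i<n. l i x * u (p i))"
    by blast
  have u: "fst w x = (\<Sum>i<n. l i x * fst w (p i))" if "w \<in> set ws" for w x
    by (rule u') (use that in simp)
  have "f x y = (\<Sum>i<n. l i x * f (p i) y)" for x y
  proof -
    have "f x y = (\<Sum>w\<leftarrow>ws. \<Sum>i<n. l i x * (fst w (p i) * snd w y))"
      unfolding ws(2)
      by (intro arg_cong[where f = sum_list] map_cong refl, subst u)
         (simp_all add: sum_distrib_right mult.assoc)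
    also have "\<dots> = (\<Sum>i<n. \<Sum>w\<leftarrow>ws. l i x * (fst w (p i) * snd w y))"
      by (induction ws) (auto simp: sum.distrib)
    also have "\<dots> = (\<Sum>i<n. l i x * f (p i) y)"
      unfolding ws(2) by (simp add: sum_list_const_mult)
    finally show ?thesis .
  qed
  with l show ?thesis using that by blast
qed

section \<open>Separability of matrix-valued functions and of
  \<open>det (Mmat SX SS SZ W H)\<close>\<close>

definition separable_mat :: "('a::topological_space \<Rightarrow> 'b::real_normed_vector \<Rightarrow> complex^'n^'m) \<Rightarrow> bool" where
  "separable_mat F \<longleftrightarrow> (\<forall>i j. separable (\<lambda>x y. F x y $ i $ j))"

lemma separable_det: "separable_mat F \<Longrightarrow> separable (\<lambda>x y. det (F x y))"
  unfolding det_def separable_mat_def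
  by (intro separable_sum separable_mult separable_const separable_prod) auto

lemma separable_mat_mult:
  "separable_mat F \<Longrightarrow> separable_mat G \<Longrightarrow> separable_mat (\<lambda>x y. F x y ** G x y)"
  unfolding separable_mat_def matrix_matrix_mult_def
  by (auto intro!: separable_sum separable_mult)

lemma separable_mat_add:
  "separable_mat F \<Longrightarrow> separable_mat G \<Longrightarrow> separable_mat (\<lambda>x y. F x y + G x y)"
  unfolding separable_mat_def by (auto intro!: separable_add)

lemma separable_mat_cadj: "separable_mat F \<Longrightarrow> separable_mat (\<lambda>x y. cadj (F x y))"
  unfolding separable_mat_def by (auto intro!: separable_cnj)

lemma separable_mat_const: "separable_mat (\<lambda>x y. A)"
  unfolding separable_mat_def by (auto intro!: separable_const)

lemma separable_mat_left: "separable_mat (\<lambda>x y. x)"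
  unfolding separable_mat_def by (auto intro!: separable_continuous continuous_intros)

lemma separable_mat_right: "separable_mat (\<lambda>x y. y)"
  unfolding separable_mat_def by (auto intro!: separable_tempered tempered_entry)

lemma separable_mat_blockM:
  assumes "separable_mat A" "separable_mat B" "separable_mat C" "separable_mat D"
  shows "separable_mat (\<lambda>x y. blockM (A x y) (B x y) (C x y) (D x y))"
  unfolding separable_mat_def
proof (intro allI)
  fix i j
  show "separable (\<lambda>x y. blockM (A x y) (B x y) (C x y) (D x y) $ i $ j)"
    using assms by (cases i; cases j) (auto simp: separable_mat_def)
qed

lemmas separable_mat_intros = separable_mat_blockM separable_mat_mult separable_mat_add
  separable_mat_cadj separable_mat_const separable_mat_left separable_mat_right

lemma separable_det_Mmat: "separable (\<lambda>W H. det (Mmat SX SS SZ W H))"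
  unfolding Mmat_def by (intro separable_det separable_mat_intros)

subsection \<open>Conditional expectations of logarithms\<close>

lemma measurable_Re_tempered: "tempered f \<Longrightarrow> (\<lambda>y. Re (f y)) \<in> borel_measurable borel"
  unfolding tempered_def by (intro borel_measurable_continuous_onI continuous_intros) auto

text \<open>The lower bound 1 makes the logarithm nonnegative, and polynomial growth bounds it by a
  constant plus a multiple of the squared norm.\<close>

lemma integrable_ln_tempered:
  fixes f :: "'b::real_normed_vector \<Rightarrow> complex" and M :: "'b measure"
  assumes M: "prob_space M" "sets M = sets borel" and int: "integrable M (\<lambda>y. (norm y)\<^sup>2)"
    and f: "tempered f" and ge: "\<And>y. 1 \<le> Re (f y)"
  shows "integrable M (\<lambda>y. ln (Re (f y)))"
proof -
  interpret prob_space M by fact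
  note [measurable_cong] = M(2)
  note [measurable] = measurable_Re_tempered[OF f]
  obtain c k where c: "0 \<le> c" "\<And>y. cmod (f y) \<le> c * (1 + (norm y)\<^sup>2) ^ k"
    using f unfolding tempered_def by blast
  show ?thesis
  proof (rule Bochner_Integration.integrable_bound)
    show "integrable M (\<lambda>y. ln (1 + c) + real k * (norm y)\<^sup>2)"
      using int by simp
    show "AE y in M. norm (ln (Re (f y))) \<le> norm (ln (1 + c) + real k * (norm y)\<^sup>2)"
    proof (intro AE_I2)
      fix y :: 'b
      have p: "0 < 1 + (norm y)\<^sup>2" by (simp add: add_pos_nonneg)
      \<comment> \<open>Enlarging \<open>c\<close> to \<open>1 + c\<close> gives a constant whose
        logarithm is defined and nonnegative even when \<open>c = 0\<close>.\<close>
      have "Re (f y) \<le> (1 + c) * (1 + (norm y)\<^sup>2) ^ k"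
        using order_trans[OF complex_Re_le_cmod c(2)] mult_right_mono[of c "1 + c" "(1 + (norm y)\<^sup>2) ^ k"] p
        by (smt (verit, best) zero_le_power)
      then have "ln (Re (f y)) \<le> ln ((1 + c) * (1 + (norm y)\<^sup>2) ^ k)"
        using ge[of y] by (intro ln_mono) auto
      also have "\<dots> = ln (1 + c) + real k * ln (1 + (norm y)\<^sup>2)"
        using c(1) p by (subst ln_mult) (auto simp: ln_realpow)
      also have "\<dots> \<le> ln (1 + c) + real k * (norm y)\<^sup>2"
        by (intro add_left_mono mult_left_mono ln_add_one_self_le_self) auto
      finally show "norm (ln (Re (f y))) \<le> norm (ln (1 + c) + real k * (norm y)\<^sup>2)"
        using ge[of y] c(1) by simp
    qed
  qed measurable
qed

text \<open>The tower property, obtained from its version for nonnegative extended integrals.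
  Finiteness of the total integral forces almost every conditional one to be finite.\<close>

lemma integrable_bind_kernel:
  fixes f :: "'b \<Rightarrow> real"
  assumes K: "K \<in> Q \<rightarrow>\<^sub>M subprob_algebra N" and f: "f \<in> borel_measurable N"
    and int: "integrable (Q \<bind> K) f" and nonneg: "\<And>y. 0 \<le> f y"
  shows "AE h in Q. integrable (K h) f"
    and "integrable Q (\<lambda>h. \<integral>y. f y \<partial>K h)"
    and "(\<integral>h. \<integral>y. f y \<partial>K h \<partial>Q) = (\<integral>y. f y \<partial>(Q \<bind> K))"
proof -
  define g where "g h = (\<integral>\<^sup>+y. ennreal (f y) \<partial>K h)" for h
  have fe: "(\<lambda>y. ennreal (f y)) \<in> borel_measurable N"
    using f by measurable
  have g: "g \<in> borel_measurable Q"
    unfolding g_def by (rule measurable_compose[OF K nn_integral_measurable_subprob_algebra[OF fe]])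
  have bind: "(\<integral>\<^sup>+y. ennreal (f y) \<partial>(Q \<bind> K)) = (\<integral>\<^sup>+h. g h \<partial>Q)"
    unfolding g_def by (rule nn_integral_bind[OF fe K])
  have fin: "(\<integral>\<^sup>+h. g h \<partial>Q) < \<infinity>"
    using int nonneg unfolding bind[symmetric] integrable_iff_bounded by (simp add: abs_of_nonneg)
  have AE: "AE h in Q. g h \<noteq> \<infinity>"
    by (rule nn_integral_PInf_AE[OF g]) (use fin in auto)
  have fK: "f \<in> borel_measurable (K h)" if "h \<in> space Q" for h
    using f sets_kernel[OF K that] by (simp cong: measurable_cong_sets)
  \<comment> \<open>This covers infinite \<open>g h\<close> too: the Bochner integral and
    \<open>enn2real\<close> both default to 0 there.\<close>
  have eq: "(\<integral>y. f y \<partial>K h) = enn2real (g h)" if "h \<in> space Q" for h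
    unfolding g_def by (rule integral_eq_nn_integral) (use fK[OF that] nonneg in auto)
  show "AE h in Q. integrable (K h) f"
    using AE AE_space
  proof eventually_elim
    case (elim h)
    then show ?case
      unfolding g_def using fK nonneg by (intro integrableI_nonneg) (auto simp: less_top)
  qed
  have nn: "(\<integral>\<^sup>+h. ennreal (enn2real (g h)) \<partial>Q) = (\<integral>\<^sup>+h. g h \<partial>Q)"
    by (rule nn_integral_cong_AE) (use AE in \<open>eventually_elim, simp add: less_top\<close>)
  have meas: "(\<lambda>h. enn2real (g h)) \<in> borel_measurable Q"
    using g by measurable
  have "integrable Q (\<lambda>h. enn2real (g h))"
    by (rule integrableI_nonneg[OF meas]) (use nn fin in auto)
  then show "integrable Q (\<lambda>h. \<integral>y. f y \<partial>K h)"
    by (subst Bochner_Integration.integrable_cong[OF refl eq])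
  have "(\<integral>h. \<integral>y. f y \<partial>K h \<partial>Q) = (\<integral>h. enn2real (g h) \<partial>Q)"
    by (rule Bochner_Integration.integral_cong[OF refl eq])
  also have "\<dots> = enn2real (\<integral>\<^sup>+h. g h \<partial>Q)"
    unfolding nn[symmetric] by (rule integral_eq_nn_integral[OF meas]) simp
  also have "\<dots> = (\<integral>y. f y \<partial>(Q \<bind> K))"
    unfolding bind[symmetric] using int nonneg
    by (intro integral_eq_nn_integral[symmetric]) auto
  finally show "(\<integral>h. \<integral>y. f y \<partial>K h \<partial>Q) = (\<integral>y. f y \<partial>(Q \<bind> K))" .
qed

text \<open>The points where a continuous function is at least a given bound form a closed set, so a
  lower bound on \<open>D\<close> persists on its closure.\<close>

lemma cINF_dense:
  fixes \<phi> :: "'w::topological_space \<Rightarrow> real"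
  assumes \<phi>: "continuous_on UNIV \<phi>" and bdd: "bdd_below (range \<phi>)"
    and D: "closure D = UNIV" "D \<noteq> {}"
  shows "(INF w. \<phi> w) = (INF w\<in>D. \<phi> w)"
proof (rule antisym)
  show "(INF w. \<phi> w) \<le> (INF w\<in>D. \<phi> w)"
    using D(2) bdd by (intro cINF_superset_mono) auto
  have "D \<subseteq> {w. (INF w\<in>D. \<phi> w) \<le> \<phi> w}"
    using bdd by (auto intro!: cINF_lower bdd_below_mono[OF bdd])
  moreover have "closed {w. (INF w\<in>D. \<phi> w) \<le> \<phi> w}"
    by (intro closed_Collect_le continuous_intros \<phi>)
  ultimately have "closure D \<subseteq> {w. (INF w\<in>D. \<phi> w) \<le> \<phi> w}"
    by (rule closure_minimal)
  then show "(INF w\<in>D. \<phi> w) \<le> (INF w. \<phi> w)"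
    unfolding D(1) by (intro cINF_greatest) auto
qed

text \<open>By interpolation, finitely many of the integrands dominate all the others, locally uniformly
  in \<open>w\<close>. So either the integral is continuous in \<open>w\<close>, and the infimum may be taken over a countable
  dense set, or one of these finitely many integrals diverges; the Bochner integral is then \<open>0\<close> by
  convention, and so is the infimum.\<close>

lemma borel_measurable_INF_integral_ln:
  fixes f :: "'w::{metric_space, second_countable_topology} \<Rightarrow> 'b::real_normed_vector \<Rightarrow> complex"
  assumes K: "K \<in> Q \<rightarrow>\<^sub>M subprob_algebra borel" and sep: "separable f"
    and real: "\<And>w y. cmod (f w y) = Re (f w y)" and ge: "\<And>w y. 1 \<le> Re (f w y)"
  shows "(\<lambda>h. INF w. \<integral>y. ln (Re (f w y)) \<partial>K h) \<in> borel_measurable Q"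
proof -
  define \<phi> where "\<phi> h w = (\<integral>y. ln (Re (f w y)) \<partial>K h)" for h w
  obtain n :: nat and l p where l: "\<And>i. i < n \<Longrightarrow> continuous_on UNIV (l i)"
    and f_eq: "\<And>w y. f w y = (\<Sum>i<n. l i w * f (p i) y)"
    using separable_interpolation[OF sep] by blast
  define good where "good h \<longleftrightarrow> (\<forall>i\<in>{..<n}. integrable (K h) (\<lambda>y. ln (Re (f (p i) y))))" for h
  obtain D :: "'w set" where D: "countable D" "closure D = UNIV" "D \<noteq> {}"
  proof -
    obtain D :: "'w set" where "countable D" "\<And>X. open X \<Longrightarrow> X \<noteq> {} \<Longrightarrow> \<exists>d\<in>D. d \<in> X"
      using countable_dense_exists by blast
    then show ?thesis
      using that[of D] by (metis UNIV_not_empty all_not_in_conv closure_interior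
          Compl_empty_eq double_complement interior_empty open_UNIV open_interior interior_subset ComplD subsetD)
  qed
  have nz: "Re (f w y) \<noteq> 0" for w y
    using ge[of w y] by auto
  have meas: "(\<lambda>y. ln (Re (f w y))) \<in> borel_measurable borel" for w
    using measurable_Re_tempered[OF separable_tempered_right[OF sep]] by measurable
  have measK: "(\<lambda>y. ln (Re (f w y))) \<in> borel_measurable (K h)" if "h \<in> space Q" for w h
    using meas[of w] sets_kernel[OF K that] by (simp cong: measurable_cong_sets)
  have \<phi>_nonneg: "0 \<le> \<phi> h w" for h w
    unfolding \<phi>_def by (intro Bochner_Integration.integral_nonneg) (use ge in simp)
  have bdd: "bdd_below (\<phi> h ` A)" for h A
    using \<phi>_nonneg by (intro bdd_belowI[of _ 0]) auto
  have \<phi>_meas: "(\<lambda>h. \<phi> h w) \<in> borel_measurable Q" for w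
    unfolding \<phi>_def
    by (rule measurable_compose[OF K integral_measurable_subprob_algebra[OF meas]])
  have good_meas: "Measurable.pred Q good"
    unfolding good_def
    by (intro pred_intros_finite measurable_compose[OF K integrable_measurable_subprob_algebra[OF meas]]) simp
  have cont: "continuous_on UNIV (\<phi> h)" if h: "h \<in> space Q" and good: "good h" for h
    unfolding continuous_on_sequentially
  proof (intro allI ballI impI, elim conjE)
    interpret subprob_space "K h" using K h by (rule subprob_space_kernel)
    fix X and w :: 'w assume X: "X \<longlonglongrightarrow> w"
    \<comment> \<open>\<open>C\<close> bounds the sum of the interpolation coefficients. Being
      continuous, it stays bounded along the convergent sequence, which makes the dominating
      function independent of \<open>m\<close>.\<close>
    define C where "C w = 1 + (\<Sum>i<n. cmod (l i w))" for w
    have "continuous_on UNIV C"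
      unfolding C_def using l by (intro continuous_intros) auto
    then have "(\<lambda>m. C (X m)) \<longlonglongrightarrow> C w"
      using X by (rule continuous_on_tendsto_compose) auto
    then have "Bseq (\<lambda>m. C (X m))"
      by (intro convergent_imp_Bseq convergentI)
    then obtain B where B: "0 < B" "\<And>m. norm (C (X m)) \<le> B"
      by (auto elim: BseqE)
    have "(\<lambda>m. \<phi> h (X m)) \<longlonglongrightarrow> \<phi> h w"
      unfolding \<phi>_def
    proof (rule integral_dominated_convergence[where w = "\<lambda>y. ln B + (\<Sum>i<n. ln (Re (f (p i) y)))"])
      show "integrable (K h) (\<lambda>y. ln B + (\<Sum>i<n. ln (Re (f (p i) y))))"
        using good unfolding good_def by (intro Bochner_Integration.integrable_add
            Bochner_Integration.integrable_sum integrable_const) auto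
      show "AE y in K h. (\<lambda>m. ln (Re (f (X m) y))) \<longlonglongrightarrow> ln (Re (f w y))"
      proof (intro AE_I2)
        fix y
        have "(\<lambda>m. f (X m) y) \<longlonglongrightarrow> f w y"
          using separable_continuous_left[OF sep] X by (rule continuous_on_tendsto_compose) auto
        then show "(\<lambda>m. ln (Re (f (X m) y))) \<longlonglongrightarrow> ln (Re (f w y))"
          using ge[of w y] by (intro tendsto_intros) auto
      qed
      show "AE y in K h. norm (ln (Re (f (X m) y))) \<le> ln B + (\<Sum>i<n. ln (Re (f (p i) y)))" for m
      proof (intro AE_I2)
        fix y
        have P: "1 \<le> (\<Prod>i<n. Re (f (p i) y))"
          by (rule prod_ge_1) (use ge in auto)
        \<comment> \<open>All factors are at least 1, so each is below the product. Bounding by the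
          product rather than the sum lets the logarithm split into the node integrands.\<close>
        have le: "Re (f (p i) y) \<le> (\<Prod>i<n. Re (f (p i) y))" if "i < n" for i
        proof -
          have "(\<Prod>i<n. Re (f (p i) y)) = Re (f (p i) y) * (\<Prod>i\<in>{..<n} - {i}. Re (f (p i) y))"
            using that by (intro prod.remove) auto
          moreover have "1 \<le> (\<Prod>i\<in>{..<n} - {i}. Re (f (p i) y))"
            by (rule prod_ge_1) (use ge in auto)
          ultimately show ?thesis
            using ge[of "p i" y] by (simp add: mult_le_cancel_left1)
        qed
        have "Re (f (X m) y) \<le> (\<Sum>i<n. cmod (l i (X m)) * Re (f (p i) y))"
          by (subst real[symmetric], subst f_eq, rule sum_norm_le) (simp add: norm_mult real)
        also have "\<dots> \<le> (\<Sum>i<n. cmod (l i (X m)) * (\<Prod>i<n. Re (f (p i) y)))"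
          by (intro sum_mono mult_left_mono le) auto
        also have "\<dots> \<le> C (X m) * (\<Prod>i<n. Re (f (p i) y))"
          using P by (simp add: C_def sum_distrib_right[symmetric] distrib_right)
        also have "\<dots> \<le> B * (\<Prod>i<n. Re (f (p i) y))"
          using P B(2)[of m] by (intro mult_right_mono) auto
        finally have "ln (Re (f (X m) y)) \<le> ln (B * (\<Prod>i<n. Re (f (p i) y)))"
          using ge[of "X m" y] by (intro ln_mono) auto
        also have "\<dots> = ln B + (\<Sum>i<n. ln (Re (f (p i) y)))"
          using B(1) P by (subst ln_mult_pos) (auto simp: ln_prod nz)
        finally show "norm (ln (Re (f (X m) y))) \<le> ln B + (\<Sum>i<n. ln (Re (f (p i) y)))"
          using ge[of "X m" y] by simp
      qed
    qed (use measK[OF h] in auto)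
    then show "(\<phi> h \<circ> X) \<longlonglongrightarrow> \<phi> h w"
      by (simp add: comp_def)
  qed
  have INF: "(INF w. \<phi> h w) = (if good h then INF w\<in>D. \<phi> h w else 0)" if h: "h \<in> space Q" for h
  proof (cases "good h")
    case True
    then show ?thesis
      using cINF_dense[OF cont[OF h True] bdd D(2,3)] by simp
  next
    case False
    then obtain i where "\<not> integrable (K h) (\<lambda>y. ln (Re (f (p i) y)))"
      unfolding good_def by blast
    then have "\<phi> h (p i) = 0"
      unfolding \<phi>_def by (rule not_integrable_integral_eq)
    then have "(INF w. \<phi> h w) \<le> 0"
      using cINF_lower[OF bdd, of "p i" UNIV h] by simp
    moreover have "0 \<le> (INF w. \<phi> h w)"
      by (rule cINF_greatest) (use \<phi>_nonneg in auto)
    ultimately show ?thesis using False by simp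
  qed
  have "(\<lambda>h. if good h then INF w\<in>D. \<phi> h w else 0) \<in> borel_measurable Q"
    using good_meas \<phi>_meas D(1) bdd by (intro measurable_If borel_measurable_cINF) (auto simp: pred_def)
  then have "(\<lambda>h. INF w. \<phi> h w) \<in> borel_measurable Q"
    by (subst measurable_cong[OF INF]) auto
  then show ?thesis unfolding \<phi>_def .
qed

subsection \<open>The rate gap\<close>

text \<open>All estimates at one fixed power. The assumption \<open>ge1\<close>, which large powers
  satisfy, keeps the logarithms of \<open>m\<close> and of its lower bound nonnegative. The last
  four conclusions supply domination and measurability for the limit.\<close>

lemma rate_gap_bounds:
  fixes Q :: "'h measure" and K :: "'h \<Rightarrow> (complex^'t^'r) measure"
    and SX SS :: "complex^'t^'t" and SZ :: "complex^'r^'r"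
  assumes Q: "prob_space Q" and K: "K \<in> Q \<rightarrow>\<^sub>M prob_algebra borel"
    and int: "integrable (Q \<bind> K) (\<lambda>H. (norm H)\<^sup>2)"
    and SX: "pos_def SX" and SS: "pos_semidef SS" and SZ: "pos_def SZ"
    and ge1: "1 \<le> Re (det SX) * Re (det SZ)"
  defines "D0 \<equiv> \<lambda>H. Re (det (SZ + H ** SX ** cadj H))"
    and "D \<equiv> \<lambda>H. Re (det (H ** (SX + SS) ** cadj H + SZ))"
  defines "gap \<equiv> (\<integral>H. ln (D0 H / Re (det SZ)) \<partial>(Q \<bind> K)) -
    (\<integral>hh. (\<integral>H. ln (Re (det SX) * D H) \<partial>K hh) - (INF W. \<integral>H. ln (Re (det (Mmat SX SS SZ W H))) \<partial>K hh) \<partial>Q)"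
  shows "0 \<le> gap"
    and "gap \<le> (\<integral>H. ln (D0 H / D H) \<partial>(Q \<bind> K)) + ln (Re (det (SX + SS)) / Re (det SX))"
    and "D0 H \<le> D H" and "Re (det SX) * D H \<le> Re (det (SX + SS)) * D0 H" and "0 < D0 H"
    and "(\<lambda>H. ln (D0 H / D H)) \<in> borel_measurable borel"
proof -
  interpret Q: prob_space Q by fact
  define x z s where "x = Re (det SX)" and "z = Re (det SZ)" and "s = Re (det (SX + SS))"
  define m where "m W H = Re (det (Mmat SX SS SZ W H))" for W and H :: "complex^'t^'r"
  have x: "0 < x" and z: "0 < z" and s: "0 < s"
    unfolding x_def z_def s_def using SX SS SZ by (auto intro: pos_def_det_pos pos_def_add)
  have xz: "1 \<le> x * z" using ge1 by (simp add: x_def z_def)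
  have pd0: "pos_def (SZ + H ** SX ** cadj H)" for H :: "complex^'t^'r"
    using SX SZ by (intro pos_def_add pos_semidef_congruence pos_def_imp_pos_semidef)
  have zD0: "z \<le> D0 H" for H
    unfolding z_def D0_def using SX SZ
    by (intro det_add_ge pos_semidef_congruence pos_def_imp_pos_semidef)
  then have D0: "0 < D0 H" for H
    using z less_le_trans by blast
  have D0D: "D0 H \<le> D H" for H
  proof -
    have eq: "H ** (SX + SS) ** cadj H + SZ = (SZ + H ** SX ** cadj H) + H ** SS ** cadj H"
      by (simp add: matrix_add_ldistrib matrix_add_rdistrib)
    show ?thesis
      unfolding D0_def D_def eq by (rule det_add_ge[OF pd0 pos_semidef_congruence[OF SS]])
  qed
  then have D: "0 < D H" for H
    using D0 less_le_trans by blast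
  have D_nz: "D0 H \<noteq> 0" "D H \<noteq> 0" for H
    using D[of H] D0[of H] by auto
  have m_lower: "x * z * (D H / D0 H) \<le> m W H" for W H
    using det_Mmat_lower_bound[OF SX SS SZ, of H W] D0[of H]
    by (simp add: x_def z_def m_def D_def D0_def field_simps)
  have ratio_ge: "1 \<le> x * z * (D H / D0 H)" for H
    using mult_mono[OF xz, of 1 "D H / D0 H"] D0D[of H] D0[of H] xz by simp
  have m_ge: "1 \<le> m W H" for W H
    using m_lower[of H W] ratio_ge[of H] by linarith
  have m_one: "m (mat 1) H = s * z" for H
    unfolding m_def det_Mmat_identity s_def z_def
    by (subst pos_def_det[OF pos_def_add[OF SX SS]], subst pos_def_det[OF SZ]) simp
  \<comment> \<open>The measurability lemma wants the determinant to equal its modulus; here it is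
    real and at least 1.\<close>
  have det_m: "cmod (det (Mmat SX SS SZ W H)) = m W H" for W H
    using det_Mmat_real[of SX SS SZ W H] SX SS SZ m_ge[of W H]
    by (metis abs_of_nonneg m_def norm_of_real order_trans pos_def_def pos_semidef_def zero_le_one)

  note Ks = measurable_prob_algebraD[OF K]
  have kernel: "prob_space (K h)" "sets (K h) = sets borel" if "h \<in> space Q" for h
    using measurable_space[OF K that] by (auto simp: space_prob_algebra)
  have Q_in: "Q \<in> space (prob_algebra Q)"
    using Q by (simp add: space_prob_algebra)
  let ?\<mu> = "Q \<bind> K"
  have \<mu>: "prob_space ?\<mu>" "sets ?\<mu> = sets borel"
    using prob_space_bind'[OF Q_in K] sets_bind'[OF Q_in K] by auto
  interpret \<mu>: prob_space ?\<mu> by fact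

  \<comment> \<open>\<open>f0\<close> is the integrand without interference, \<open>f1\<close> the
    first integrand of the achievable rate, and \<open>f2\<close> their difference, which is also
    the logarithm of the lower bound on \<open>m\<close> valid for every \<open>W\<close>.\<close>
  define f0 where "f0 H = ln (D0 H / z)" for H
  define f1 where "f1 H = ln (x * D H)" for H
  define f2 where "f2 H = ln (x * z * (D H / D0 H))" for H
  have f2_eq: "f2 H = f1 H - f0 H" for H
    using x z D[of H] D0[of H] by (simp add: f0_def f1_def f2_def ln_mult_pos ln_div)
  \<comment> \<open>The left argument is a dummy: separability is used only to obtain temperedness
    in \<open>H\<close>.\<close>
  have sep_D0: "separable (\<lambda>(W::complex^'t^'t) H. det (SZ + H ** SX ** cadj H))"
    by (intro separable_det separable_mat_intros)
  have sep_D: "separable (\<lambda>(W::complex^'t^'t) H. det (H ** (SX + SS) ** cadj H + SZ))"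
    by (intro separable_det separable_mat_intros)
  have f0_temp: "tempered (\<lambda>H. of_real (inverse z) * det (SZ + H ** SX ** cadj H))"
    by (intro tempered_mult tempered_const separable_tempered_right[OF sep_D0])
  have f1_temp: "tempered (\<lambda>H. of_real x * det (H ** (SX + SS) ** cadj H + SZ))"
    by (intro tempered_mult tempered_const separable_tempered_right[OF sep_D])
  have f0_int: "integrable ?\<mu> f0"
  proof -
    have eq: "Re (of_real (inverse z) * det (SZ + H ** SX ** cadj H)) = D0 H / z" for H
      unfolding D0_def divide_inverse by (simp del: of_real_inverse)
    have "1 \<le> D0 H / z" for H
      using zD0[of H] z by simp
    then show ?thesis
      using integrable_ln_tempered[OF \<mu> int f0_temp] unfolding eq f0_def[abs_def] by blast
  qed
  have xD: "1 \<le> x * D H" for H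
  proof -
    have "x * z \<le> x * D H"
      using order_trans[OF zD0 D0D] x by (intro mult_left_mono) auto
    then show ?thesis using xz by linarith
  qed
  have f1_int: "integrable ?\<mu> f1"
  proof -
    have eq: "Re (of_real x * det (H ** (SX + SS) ** cadj H + SZ)) = x * D H" for H
      by (simp add: D_def)
    show ?thesis
      using integrable_ln_tempered[OF \<mu> int f1_temp] xD unfolding eq f1_def[abs_def] by blast
  qed
  have f2_int: "integrable ?\<mu> f2"
    unfolding f2_eq[abs_def] using f0_int f1_int by simp
  have [measurable]: "D0 \<in> borel_measurable borel" "D \<in> borel_measurable borel"
    unfolding D0_def D_def
    using measurable_Re_tempered[OF separable_tempered_right[OF sep_D0]]
      measurable_Re_tempered[OF separable_tempered_right[OF sep_D]] by auto
  have f1_meas: "f1 \<in> borel_measurable borel" and f2_meas: "f2 \<in> borel_measurable borel"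
    unfolding f1_def[abs_def] f2_def[abs_def] by measurable
  have f1_nonneg: "0 \<le> f1 H" and f2_nonneg: "0 \<le> f2 H" for H
    using xD[of H] ratio_ge[of H] by (auto simp: f1_def f2_def)

  define g where "g h = (INF W. \<integral>H. ln (m W H) \<partial>K h)" for h
  have g_meas: "g \<in> borel_measurable Q"
    unfolding g_def m_def
    by (rule borel_measurable_INF_integral_ln[OF Ks separable_det_Mmat])
       (use det_m m_ge in \<open>auto simp: m_def\<close>)
  have int_nonneg: "0 \<le> (\<integral>H. ln (m W H) \<partial>K h)" for W h
    by (intro Bochner_Integration.integral_nonneg) (use m_ge in simp)
  have g_nonneg: "0 \<le> g h" for h
    unfolding g_def by (rule cINF_greatest) (use int_nonneg in auto)
  \<comment> \<open>At \<open>W = mat 1\<close> the integrand is the constant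
    \<open>ln (s * z)\<close>, so \<open>g\<close> is bounded on all of the space and thus
    integrable.\<close>
  have g_le: "g h \<le> ln (s * z)" if "h \<in> space Q" for h
  proof -
    interpret prob_space "K h" using kernel[OF that] by simp
    have "g h \<le> (\<integral>H. ln (m (mat 1) H) \<partial>K h)"
      unfolding g_def by (rule cINF_lower) (use int_nonneg in \<open>auto intro: bdd_belowI[of _ 0]\<close>)
    then show ?thesis by (simp add: m_one prob_space)
  qed
  have g_int: "integrable Q g"
    by (rule Q.integrable_const_bound[OF _ g_meas, of "ln (s * z)"])
       (use g_nonneg g_le in auto)
  note f1_kernel = integrable_bind_kernel[OF Ks f1_meas f1_int f1_nonneg]
  note f2_kernel = integrable_bind_kernel[OF Ks f2_meas f2_int f2_nonneg]
  \<comment> \<open>For almost every \<open>h\<close> the conditional second moment is finite, so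
    the integrals of \<open>ln (m W H)\<close> are genuine for all \<open>W\<close> at once.
    Otherwise the default value 0 could fall below the integral of \<open>f2\<close>.\<close>
  have norm_kernel: "AE h in Q. integrable (K h) (\<lambda>H. (norm H)\<^sup>2)"
    by (rule integrable_bind_kernel(1)[OF Ks _ int]) auto
  have gap_eq: "gap = (\<integral>h. g h \<partial>Q) - (\<integral>H. f2 H \<partial>?\<mu>)"
  proof -
    have "(\<integral>h. (\<integral>H. f1 H \<partial>K h) - g h \<partial>Q) = (\<integral>H. f1 H \<partial>?\<mu>) - (\<integral>h. g h \<partial>Q)"
      using f1_kernel(2,3) g_int by simp
    moreover have "(\<integral>H. f2 H \<partial>?\<mu>) = (\<integral>H. f1 H \<partial>?\<mu>) - (\<integral>H. f0 H \<partial>?\<mu>)"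
      unfolding f2_eq using f0_int f1_int by simp
    moreover have "gap = (\<integral>H. f0 H \<partial>?\<mu>) - (\<integral>h. (\<integral>H. f1 H \<partial>K h) - g h \<partial>Q)"
      unfolding gap_def f0_def f1_def g_def m_def x_def z_def ..
    ultimately show ?thesis by simp
  qed
  have "(\<integral>h. \<integral>H. f2 H \<partial>K h \<partial>Q) \<le> (\<integral>h. g h \<partial>Q)"
  proof (rule integral_mono_AE[OF f2_kernel(2) g_int])
    show "AE h in Q. (\<integral>H. f2 H \<partial>K h) \<le> g h"
      using norm_kernel f2_kernel(1) AE_space
    proof eventually_elim
      case (elim h)
      have "(\<integral>H. f2 H \<partial>K h) \<le> (\<integral>H. ln (m W H) \<partial>K h)" for W
      proof (rule integral_mono[OF elim(2)])
        show "integrable (K h) (\<lambda>H. ln (m W H))"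
          unfolding m_def
          by (rule integrable_ln_tempered[OF kernel[OF elim(3)] elim(1)
                separable_tempered_right[OF separable_det_Mmat]])
             (use m_ge in \<open>auto simp: m_def\<close>)
        show "f2 H \<le> ln (m W H)" for H
          unfolding f2_def using m_lower[of H W] ratio_ge[of H] by (intro ln_mono) auto
      qed
      then show ?case
        unfolding g_def by (intro cINF_greatest) auto
    qed
  qed
  then show "0 \<le> gap"
    unfolding gap_eq f2_kernel(3) by simp
  have "(\<integral>h. g h \<partial>Q) \<le> (\<integral>h. ln (s * z) \<partial>Q)"
    by (rule integral_mono[OF g_int]) (use g_le in auto)
  then have "gap \<le> ln (s * z) - (\<integral>H. f2 H \<partial>?\<mu>)"
    unfolding gap_eq by (simp add: Q.prob_space)
  also have "\<dots> = (\<integral>H. ln (s * z) - f2 H \<partial>?\<mu>)"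
    using f2_int by (simp add: \<mu>.prob_space)
  \<comment> \<open>The noise determinant \<open>z\<close> cancels between the two
    logarithms.\<close>
  also have "\<dots> = (\<integral>H. ln (D0 H / D H) + ln (s / x) \<partial>?\<mu>)"
    by (intro Bochner_Integration.integral_cong refl)
      (use s x z in \<open>simp add: f2_def D_nz ln_mult ln_div\<close>)
  also have "\<dots> = (\<integral>H. ln (D0 H / D H) \<partial>?\<mu>) + ln (s / x)"
  proof -
    have "(\<lambda>H. ln (D0 H / D H)) = (\<lambda>H. ln (x * z) - f2 H)"
      using x z by (intro ext) (simp add: f2_def D_nz ln_mult ln_div)
    then have "integrable ?\<mu> (\<lambda>H. ln (D0 H / D H))"
      using f2_int by simp
    then show ?thesis by (simp add: \<mu>.prob_space)
  qed
  finally show "gap \<le> (\<integral>H. ln (D0 H / D H) \<partial>?\<mu>) + ln (Re (det (SX + SS)) / Re (det SX))"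
    by (simp add: s_def x_def)
  show "D0 H \<le> D H" "0 < D0 H" by (fact D0D, fact D0)
  show "Re (det SX) * D H \<le> Re (det (SX + SS)) * D0 H"
    \<comment> \<open>At \<open>W = mat 1\<close> the lower bound reads
      \<open>x * z * (D H / D0 H) \<le> s * z\<close>; dividing by \<open>z\<close> leaves the
      claim.\<close>
    using m_lower[of H "mat 1"] D0[of H] z unfolding m_one x_def[symmetric] s_def[symmetric]
    by (simp add: field_simps)
  show "(\<lambda>H. ln (D0 H / D H)) \<in> borel_measurable borel"
    by measurable
qed


theorem theorem2:
  fixes Q :: "'h measure"
    and K :: "'h \<Rightarrow> (complex^'t^'r) measure"
    and SZ :: "complex^'r^'r"
    and SX' SS' :: "complex^'t^'t"
  assumes "CARD('t) \<le> CARD('r)"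
    and "prob_space Q"
    and "K \<in> Q \<rightarrow>\<^sub>M prob_algebra borel"
    and "AE H in Q \<bind> K. rank H = CARD('t)"
    and "integrable (Q \<bind> K) (\<lambda>H. (norm H)\<^sup>2)"
    and "integrable (Q \<bind> K) (\<lambda>H. ln (Re (det (cadj H ** H))))"
    and "pos_def SZ"
    and "pos_def SX'" and "Re (trace SX') \<le> 1"
    and "pos_semidef SS'"
  shows "((\<lambda>P. R0 Q K SZ SX' P - Rach Q K SZ SX' SS' P) \<longlongrightarrow> 0) at_top"
proof -
  let ?\<mu> = "Q \<bind> K"
  define x z s where "x = Re (det SX')" and "z = Re (det SZ)" and "s = Re (det (SX' + SS'))"
  \<comment> \<open>From \<open>P0\<close> on,
    \<open>P ^ CARD('t) \<ge> P \<ge> 1 / (x * z)\<close>, which is the assumption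
    \<open>ge1\<close> of \<open>rate_gap_bounds\<close> for the scaled covariances.\<close>
  define P0 where "P0 = max 1 (1 / (x * z))"
  define D0 where "D0 P H = Re (det (SZ + H ** (P *\<^sub>R SX') ** cadj H))" for P and H :: "complex^'t^'r"
  define D where "D P H = Re (det (H ** (P *\<^sub>R SX' + P *\<^sub>R SS') ** cadj H + SZ))" for P and H :: "complex^'t^'r"
  have pd: "pos_def (SX' + SS')"
    using assms by (intro pos_def_add)
  have x: "0 < x" and z: "0 < z" and s: "0 < s"
    unfolding x_def z_def s_def using assms pd by (auto intro: pos_def_det_pos)
  have dets: "1 \<le> Re (det (P *\<^sub>R SX')) * Re (det SZ)"
    and det_ratio: "Re (det (P *\<^sub>R SX' + P *\<^sub>R SS')) / Re (det (P *\<^sub>R SX')) = s / x"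
    and pds: "pos_def (P *\<^sub>R SX')" "pos_semidef (P *\<^sub>R SS')"
    and scale: "Re (det (P *\<^sub>R SX')) = P ^ CARD('t) * x"
      "Re (det (P *\<^sub>R SX' + P *\<^sub>R SS')) = P ^ CARD('t) * s" and P_pos: "0 < P"
    if P: "P0 \<le> P" for P
  proof -
    have P1: "1 \<le> P" "1 / (x * z) \<le> P" using P by (auto simp: P0_def)
    show "0 < P" using P1 by simp
    have "P ^ 1 \<le> P ^ CARD('t)"
      using P1 by (intro power_increasing) (simp_all add: Suc_leI)
    then have "1 / (x * z) \<le> P ^ CARD('t)" using P1 by simp
    then have "1 \<le> P ^ CARD('t) * x * z"
      using x z by (simp add: field_simps)
    then show "1 \<le> Re (det (P *\<^sub>R SX')) * Re (det SZ)"
      by (simp add: Re_det_scaleR x_def z_def)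
    show sc: "Re (det (P *\<^sub>R SX')) = P ^ CARD('t) * x"
      "Re (det (P *\<^sub>R SX' + P *\<^sub>R SS')) = P ^ CARD('t) * s"
      by (simp_all add: Re_det_scaleR x_def s_def flip: scaleR_add_right)
    show "Re (det (P *\<^sub>R SX' + P *\<^sub>R SS')) / Re (det (P *\<^sub>R SX')) = s / x"
      unfolding sc using P1 by simp
    show "pos_def (P *\<^sub>R SX')" "pos_semidef (P *\<^sub>R SS')"
      using assms P1 by (auto intro: pos_def_scaleR pos_semidef_scaleR)
  qed
  note bounds = rate_gap_bounds[OF assms(2,3,5) pds assms(7) dets]
  have D_bounds: "D0 P H \<le> D P H" "x * D P H \<le> s * D0 P H" "0 < D0 P H" if P: "P0 \<le> P" for P H
  proof -
    show "D0 P H \<le> D P H" "0 < D0 P H"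
      unfolding D0_def D_def using bounds(3,5)[OF P P P] by blast+
    show "x * D P H \<le> s * D0 P H"
      using bounds(4)[OF P P P, of H] P_pos[OF P]
      unfolding scale[OF P] D0_def D_def by (simp add: mult.assoc)
  qed
  have upper: "((\<lambda>P. (\<integral>H. ln (D0 P H / D P H) \<partial>?\<mu>) + ln (s / x)) \<longlongrightarrow> 0) at_top"
  proof -
    have Q_in: "Q \<in> space (prob_algebra Q)"
      using assms(2) by (simp add: space_prob_algebra)
    interpret \<mu>: prob_space ?\<mu>
      using prob_space_bind'[OF Q_in assms(3)] .
    have sets: "sets ?\<mu> = sets borel"
      using sets_bind'[OF Q_in assms(3)] .
    have meas: "(\<lambda>H. ln (D0 P H / D P H)) \<in> borel_measurable ?\<mu>" if P: "P0 \<le> P" for P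
      using bounds(6)[OF P P P] sets unfolding D0_def D_def by (simp cong: measurable_cong_sets)
    have lim: "((\<lambda>P. ln (D0 P H / D P H)) \<longlongrightarrow> ln (x / s)) at_top" if H: "rank H = CARD('t)" for H
    proof (rule tendsto_ln)
      have "D P H = Re (det (SZ + H ** (P *\<^sub>R (SX' + SS')) ** cadj H))" for P
        by (simp add: D_def scaleR_add_right add.commute)
      then show "((\<lambda>P. D0 P H / D P H) \<longlongrightarrow> x / s) at_top"
        using det_ratio_tendsto[OF assms(7,8) pd H] by (simp add: D0_def x_def s_def)
    qed (use x s in simp)
    \<comment> \<open>The ratio lies between \<open>x / s\<close> and 1 uniformly in
      \<open>P\<close> and \<open>H\<close>, so a constant dominates.\<close>
    have bound: "\<bar>ln (D0 P H / D P H)\<bar> \<le> ln (s / x)" if P: "P0 \<le> P" for P H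
    proof -
      note D = D_bounds[OF P, of H]
      have "D0 P H / D P H \<le> 1" "x / s \<le> D0 P H / D P H" "0 < D0 P H / D P H"
        using D x s by (simp_all add: field_simps)
      then have "ln (x / s) \<le> ln (D0 P H / D P H)" "ln (D0 P H / D P H) \<le> 0"
        using x s by (auto intro!: ln_mono simp: ln_le_zero_iff)
      then show ?thesis using x s by (simp add: ln_div)
    qed
    \<comment> \<open>Freezing the power below \<open>P0\<close> makes the integrand measurable for
      every \<open>P\<close>, as the convergence theorem demands, without changing the
      limit.\<close>
    define F where "F P H = ln (D0 (max P0 P) H / D (max P0 P) H)" for P H
    have "((\<lambda>P. \<integral>H. F P H \<partial>?\<mu>) \<longlongrightarrow> (\<integral>H. ln (x / s) \<partial>?\<mu>)) at_top"
    proof (rule integral_dominated_convergence_at_top[where w = "\<lambda>_. ln (s / x)"])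
      show "\<And>P. F P \<in> borel_measurable ?\<mu>"
        unfolding F_def by (rule meas) simp
      show "\<forall>\<^sub>F P in at_top. AE H in ?\<mu>. norm (F P H) \<le> ln (s / x)"
        unfolding F_def using bound by (intro always_eventually allI AE_I2) simp
      show "AE H in ?\<mu>. ((\<lambda>P. F P H) \<longlongrightarrow> ln (x / s)) at_top"
        using assms(4)
      proof eventually_elim
        case (elim H)
        show ?case
        proof (rule Lim_transform_eventually[OF lim[OF elim]])
          show "\<forall>\<^sub>F P in at_top. ln (D0 P H / D P H) = F P H"
            using eventually_ge_at_top[of P0] by eventually_elim (simp add: F_def max_def)
        qed
      qed
    qed simp_all
    then have "((\<lambda>P. \<integral>H. F P H \<partial>?\<mu>) \<longlongrightarrow> ln (x / s)) at_top"
      by (simp add: \<mu>.prob_space)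
    then have "((\<lambda>P. (\<integral>H. F P H \<partial>?\<mu>) + ln (s / x)) \<longlongrightarrow> ln (x / s) + ln (s / x)) at_top"
      by (intro tendsto_intros)
    moreover have "ln (x / s) + ln (s / x) = 0"
      using x s by (simp add: ln_div)
    moreover have "\<forall>\<^sub>F P in at_top. (\<integral>H. F P H \<partial>?\<mu>) + ln (s / x) =
        (\<integral>H. ln (D0 P H / D P H) \<partial>?\<mu>) + ln (s / x)"
      using eventually_ge_at_top[of P0] by eventually_elim (simp add: F_def max_def)
    ultimately show ?thesis
      by (auto elim: Lim_transform_eventually)
  qed
  show ?thesis
  \<comment> \<open>The gap lies between 0 and the upper bound at \<open>W = mat 1\<close>, whose
    two terms cancel in the limit.\<close>
  proof (rule tendsto_sandwich[OF _ _ tendsto_const upper])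
    show "\<forall>\<^sub>F P in at_top. 0 \<le> R0 Q K SZ SX' P - Rach Q K SZ SX' SS' P"
      using eventually_ge_at_top[of P0]
    proof eventually_elim
      case (elim P)
      show ?case
        using bounds(1)[OF elim elim elim] by (simp add: R0_def Rach_def Let_def)
    qed
    show "\<forall>\<^sub>F P in at_top. R0 Q K SZ SX' P - Rach Q K SZ SX' SS' P
        \<le> (\<integral>H. ln (D0 P H / D P H) \<partial>?\<mu>) + ln (s / x)"
      using eventually_ge_at_top[of P0]
    proof eventually_elim
      case (elim P)
      show ?case
        using bounds(2)[OF elim elim elim] unfolding det_ratio[OF elim]
        by (simp add: R0_def Rach_def Let_def D0_def D_def)
    qed
  qed
qed

end
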